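(* There exists a $4$-branch piecewise linear expanding map $T: X=\bigcup_{i=1}^4 X_i\to[0,1]$ whose Lyapunov spectrum has exactly $4$ inflections, i.e. $T$ has exactly $4$ Lyapunov inflections.
   Context: An $n$-branch piecewise linear expanding map is a map $T: X=\bigcup_{i=1}^n X_i\to[0,1]$, where $X_1,\dots,X_n\subset[0,1]$ are closed intervals with pairwise disjoint interiors, each $T|_{X_i}$ is affine and maps $X_i$ onto $[0,1]$, and $|T'|=x_i:=|X_i|^{-1}>1$ on $X_i$ (the numbers $x_i$ are called the slopes; ambiguities at common endpoints are irrelevant). Indices are arranged so that $1<x_1\le x_2\le\cdots\le x_n$; slopes may coincide. The repeller is $\Lambda=\bigcap_{k\ge 0}T^{-k}(X)$. The Lyapunov exponent at $x\in\Lambda$ is $\lambda(x)=\lim_{m\to\infty}\frac1m\log|(T^m)'(x)|$ when the limit exists. The Lyapunov spectrum is $L(\alpha)=\dim_H\{x\in\Lambda:\lambda(x)=\alpha\}$ (Hausdorff dimension), defined for those $\alpha$ with nonempty level set; its domain is $[\log x_1,\log x_n]$. A Lyapunov inflection of $T$ is a point $\alpha\in(\log x_1,\log x_n)$ with $L''(\alpha)=0$. If the slopes are not all equal, put $F(t)=\sum_{i=1}^n x_i^t$. Then $\alpha(t)=F'(t)/F(t)$ is an increasing bijection from $\mathbb{R}$ onto $(\log x_1,\log x_n)$, and $L(\alpha(t))=\frac{F(t)\log F(t)}{F'(t)}-t$. *)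

theory Defs
  imports "HOL-Analysis.Analysis"
begin

subsection \<open>Hausdorff dimension\<close>

definition hausdorff_content :: "real \<Rightarrow> real \<Rightarrow> 'a::metric_space set \<Rightarrow> ennreal" where
  "hausdorff_content \<delta> s A =
     (INF U \<in> {U :: nat \<Rightarrow> 'a set. A \<subseteq> (\<Union>i. U i) \<and> (\<forall>i. bounded (U i) \<and> diameter (U i) \<le> \<delta>)}.
        \<Sum>i. ennreal (diameter (U i) powr s))"

definition hausdorff_measure :: "real \<Rightarrow> 'a::metric_space set \<Rightarrow> ennreal" where
  "hausdorff_measure s A = (SUP \<delta> \<in> {0<..}. hausdorff_content \<delta> s A)"

text \<open>
  Only exponents \<open>s > 0\<close> occur, since \<open>0 powr 0 = 0\<close> makes \<open>hausdorff_measure 0\<close> differ from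
  counting measure.  The infimum is not affected by leaving out \<open>s = 0\<close>; the empty set gets
  dimension \<open>0\<close>.
\<close>

definition hausdorff_dim :: "'a::metric_space set \<Rightarrow> ennreal" where
  "hausdorff_dim A = Inf {ennreal s | s. 0 < s \<and> hausdorff_measure s A = 0}"


subsection \<open>Piecewise linear expanding maps\<close>

text \<open>
  A map with \<open>n\<close> branches is given by the intervals \<open>X i\<close> and the branches \<open>f i\<close>, the latter standing
  for the restriction of the map to \<open>X i\<close>, where \<open>i\<close> ranges over \<open>{1..n}\<close>.
\<close>

definition slope :: "(nat \<Rightarrow> real set) \<Rightarrow> nat \<Rightarrow> real" where
  "slope X i = 1 / measure lborel (X i)"

definition pl_expanding_map ::
    "nat \<Rightarrow> (nat \<Rightarrow> real set) \<Rightarrow> (nat \<Rightarrow> real \<Rightarrow> real) \<Rightarrow> bool" where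
  "pl_expanding_map n X f \<longleftrightarrow>
     (\<forall>i\<in>{1..n}. (\<exists>a b. a < b \<and> X i = {a..b}) \<and> X i \<subseteq> {0..1}) \<and>
     (\<forall>i\<in>{1..n}. \<forall>j\<in>{1..n}. i \<noteq> j \<longrightarrow> interior (X i) \<inter> interior (X j) = {}) \<and>
     (\<forall>i\<in>{1..n}. (\<exists>c d. \<bar>c\<bar> = slope X i \<and> (\<forall>x\<in>X i. f i x = c * x + d)) \<and> f i ` X i = {0..1}) \<and>
     (\<forall>i\<in>{1..n}. 1 < slope X i) \<and>
     (\<forall>i\<in>{1..n}. \<forall>j\<in>{1..n}. i \<le> j \<longrightarrow> slope X i \<le> slope X j)"

definition pl_domain :: "nat \<Rightarrow> (nat \<Rightarrow> real set) \<Rightarrow> real set" where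
  "pl_domain n X = (\<Union>i\<in>{1..n}. X i)"

text \<open>
  At a common endpoint of two intervals the branch of smaller index is used, both for the map and
  for its derivative.  Outside \<open>pl_domain n X\<close> the values of \<open>pl_map\<close> are meaningless.
\<close>

definition branch_at :: "nat \<Rightarrow> (nat \<Rightarrow> real set) \<Rightarrow> real \<Rightarrow> nat" where
  "branch_at n X x = (LEAST i. i \<in> {1..n} \<and> x \<in> X i)"

definition pl_map ::
    "nat \<Rightarrow> (nat \<Rightarrow> real set) \<Rightarrow> (nat \<Rightarrow> real \<Rightarrow> real) \<Rightarrow> real \<Rightarrow> real" where
  "pl_map n X f x = f (branch_at n X x) x"

text \<open>
  As \<open>k\<close> ranges over all naturals, membership below forces the whole orbit to stay in the domain,
  so the values of \<open>pl_map\<close> outside it play no role.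
\<close>

definition repeller :: "nat \<Rightarrow> (nat \<Rightarrow> real set) \<Rightarrow> (nat \<Rightarrow> real \<Rightarrow> real) \<Rightarrow> real set" where
  "repeller n X f = (\<Inter>k. (pl_map n X f ^^ k) -` pl_domain n X)"


subsection \<open>Lyapunov spectrum\<close>

text \<open>
  The absolute value of the derivative of the \<open>m\<close>-th iterate on the repeller, by the chain rule:
  the derivative of the map has absolute value \<open>slope X i\<close> on \<open>X i\<close>, endpoints included.
\<close>

definition abs_deriv_iterate ::
    "nat \<Rightarrow> (nat \<Rightarrow> real set) \<Rightarrow> (nat \<Rightarrow> real \<Rightarrow> real) \<Rightarrow> nat \<Rightarrow> real \<Rightarrow> real" where
  "abs_deriv_iterate n X f m x =
     (\<Prod>k<m. slope X (branch_at n X ((pl_map n X f ^^ k) x)))"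

definition has_lyapunov_exponent ::
    "nat \<Rightarrow> (nat \<Rightarrow> real set) \<Rightarrow> (nat \<Rightarrow> real \<Rightarrow> real) \<Rightarrow> real \<Rightarrow> real \<Rightarrow> bool" where
  "has_lyapunov_exponent n X f x \<alpha> \<longleftrightarrow>
     (\<lambda>m. 1 / real m * ln (abs_deriv_iterate n X f m x)) \<longlonglongrightarrow> \<alpha>"

definition lyapunov_spectrum ::
    "nat \<Rightarrow> (nat \<Rightarrow> real set) \<Rightarrow> (nat \<Rightarrow> real \<Rightarrow> real) \<Rightarrow> real \<Rightarrow> real" where
  "lyapunov_spectrum n X f \<alpha> =
     enn2real (hausdorff_dim {x \<in> repeller n X f. has_lyapunov_exponent n X f x \<alpha>})"

text \<open>
  The vanishing of the second derivative includes its existence; \<open>deriv\<close> alone would take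
  arbitrary values at points where the spectrum is not differentiable.
\<close>

definition lyapunov_inflection ::
    "nat \<Rightarrow> (nat \<Rightarrow> real set) \<Rightarrow> (nat \<Rightarrow> real \<Rightarrow> real) \<Rightarrow> real \<Rightarrow> bool" where
  "lyapunov_inflection n X f \<alpha> \<longleftrightarrow>
     \<alpha> \<in> {ln (slope X 1)<..<ln (slope X n)} \<and>
     (\<forall>\<^sub>F \<beta> in nhds \<alpha>. lyapunov_spectrum n X f differentiable (at \<beta>)) \<and>
     (deriv (lyapunov_spectrum n X f) has_real_derivative 0) (at \<alpha>)"

end

theory Submission imports Defs "HOL-Probability.Probability" begin

text \<open>
  Let the branches be separated by gaps and let the \<open>i\<close>-th slope be \<open>exp (l i)\<close>.  With the pressure
  \<open>P t = ln (\<Sum>i. exp (t * l i))\<close> the spectrum satisfies \<open>L (P' t) = P t / P' t - t\<close>: the upper bound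
  comes from covering a level set by the cylinders whose Birkhoff sum is nearly right, the lower
  bound from the mass distribution principle for the Bernoulli measure with weights
  \<open>exp (t * l i - P t)\<close>, which by a Chernoff bound lives on the level set.

  Hence \<open>P' t\<close> is an inflection iff \<open>H = P - P'\<^sup>2 / (2 * P'')\<close> vanishes at \<open>t\<close>.  Since
  \<open>H' = P'\<^sup>2 * P''' / (2 * P''\<^sup>2)\<close>, the function \<open>H\<close> has at most one zero more than \<open>P'''\<close>.  For the
  exponents \<open>3, 63, 63, 12003\<close> and \<open>z = exp (60 * t)\<close>, the zeros of \<open>P'''\<close> are the positive roots of a
  polynomial in \<open>z\<close> whose coefficients change sign three times, so \<open>H\<close> has at most four zeros; its
  signs at \<open>z = 1/64, 1/2, 9/10, 1, 2\<close> alternate, so it has exactly four.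
\<close>

section \<open>Countable covers and sums over words of all lengths\<close>

text \<open>\<open>hausdorff_content\<close> admits only covers indexed by \<open>nat\<close>, while
  cylinders come indexed by pairs of a length and a word. An enumeration of the index set is padded
  with empty sets, which cost nothing because they have diameter 0 and
  \<open>0 powr s = 0\<close>.\<close>

lemma hausdorff_content_countable_cover_le:
  fixes U :: "'i \<Rightarrow> 'a::metric_space set"
  assumes "countable I" "0 \<le> \<delta>" "A \<subseteq> (\<Union>i\<in>I. U i)"
    and "\<And>i. i \<in> I \<Longrightarrow> bounded (U i) \<and> diameter (U i) \<le> \<delta>"
  shows "hausdorff_content \<delta> s A \<le> (\<integral>\<^sup>+i. ennreal (diameter (U i) powr s) \<partial>count_space I)"
proof -
  define V where "V k = (if k \<in> to_nat_on I ` I then U (from_nat_into I k) else {})" for k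
  have inj: "inj_on (to_nat_on I) I" using assms(1) by (rule inj_on_to_nat_on)
  have V_eq: "V (to_nat_on I i) = U i" if "i \<in> I" for i
    using that assms(1) by (auto simp: V_def)
  have "A \<subseteq> (\<Union>k. V k)"
    using assms(3) V_eq by fastforce
  moreover have "bounded (V k) \<and> diameter (V k) \<le> \<delta>" for k
    using assms(2,4) V_eq by (cases "k \<in> to_nat_on I ` I") (auto simp: V_def)
  ultimately have "hausdorff_content \<delta> s A \<le> (\<Sum>k. ennreal (diameter (V k) powr s))"
    unfolding hausdorff_content_def by (intro INF_lower) auto
  also have "\<dots> = (\<integral>\<^sup>+k. ennreal (diameter (V k) powr s) \<partial>count_space UNIV)"
    by (simp add: nn_integral_count_space_nat)
  also have "\<dots> = (\<integral>\<^sup>+k. ennreal (diameter (V k) powr s) \<partial>count_space (to_nat_on I ` I))"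
    by (rule nn_integral_count_space_eq) (auto simp: V_def)
  also have "\<dots> = (\<integral>\<^sup>+i. ennreal (diameter (V (to_nat_on I i)) powr s) \<partial>count_space I)"
    using inj by (intro nn_integral_bij_count_space[symmetric]) (auto simp: bij_betw_def)
  also have "\<dots> = (\<integral>\<^sup>+i. ennreal (diameter (U i) powr s) \<partial>count_space I)"
    by (intro nn_integral_cong) (auto simp: V_eq)
  finally show ?thesis .
qed

text \<open>Each pair lies in exactly one fibre of \<open>fst\<close>, so the summand can be split
  by fibres and the sum interchanged with the integral. This groups the cost of a cover by word
  length.\<close>

lemma nn_integral_count_space_Sigma_finite:
  fixes f :: "nat \<times> 'b \<Rightarrow> ennreal"
  assumes "\<And>m. finite (B m)"
  shows "(\<integral>\<^sup>+p. f p \<partial>count_space (SIGMA m:UNIV. B m)) = (\<Sum>m. \<Sum>w\<in>B m. f (m, w))"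
proof -
  let ?I = "SIGMA m:UNIV. B m"
  have "(\<integral>\<^sup>+p. f p \<partial>count_space ?I) = (\<integral>\<^sup>+p. (\<Sum>m. f p * indicator {q. fst q = m} p) \<partial>count_space ?I)"
  proof (intro nn_integral_cong)
    fix p
    have "(\<Sum>m. f p * indicator {q. fst q = m} p) = (\<Sum>m\<in>{fst p}. f p * indicator {q. fst q = m} p)"
      by (rule suminf_finite) auto
    then show "f p = (\<Sum>m. f p * indicator {q. fst q = m} p)" by simp
  qed
  also have "\<dots> = (\<Sum>m. \<integral>\<^sup>+p. f p * indicator {q. fst q = m} p \<partial>count_space ?I)"
    by (rule nn_integral_suminf) auto
  also have "\<dots> = (\<Sum>m. \<Sum>w\<in>B m. f (m, w))"
  proof (intro suminf_cong)
    fix m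
    have "(\<integral>\<^sup>+p. f p * indicator {q. fst q = m} p \<partial>count_space ?I)
        = (\<integral>\<^sup>+p. f p \<partial>count_space (Pair m ` B m))"
      by (subst (1 2) nn_integral_count_space_indicator)
         (auto intro!: nn_integral_cong simp: indicator_def)
    also have "\<dots> = (\<Sum>p\<in>Pair m ` B m. f p)"
      using assms by (intro nn_integral_count_space_finite) auto
    also have "\<dots> = (\<Sum>w\<in>B m. f (m, w))"
      by (subst sum.reindex) (auto simp: inj_on_def)
    finally show "(\<integral>\<^sup>+p. f p * indicator {q. fst q = m} p \<partial>count_space ?I) = (\<Sum>w\<in>B m. f (m, w))" .
  qed
  finally show ?thesis .
qed

subsection \<open>Coding and cylinders\<close>

text \<open>Branches of length \<open>exp (- l i)\<close> starting at \<open>a i\<close>, with gaps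
  of at least \<open>g\<close>. The gaps make itineraries unambiguous and bound distances from
  below. Asking for them costs nothing, as the formula obtained for the spectrum involves only the
  exponents \<open>l\<close>.\<close>

locale separated_pl_map =
  fixes n :: nat and l a :: "nat \<Rightarrow> real" and g :: real
  assumes n_pos: "0 < n"
    and l_pos: "i \<in> {1..n} \<Longrightarrow> 0 < l i"
    and a_nonneg: "i \<in> {1..n} \<Longrightarrow> 0 \<le> a i"
    and a_le: "i \<in> {1..n} \<Longrightarrow> a i + exp (- l i) \<le> 1"
    and g_pos: "0 < g"
    and separated: "\<lbrakk>i \<in> {1..n}; j \<in> {1..n}; i \<noteq> j; x \<in> {a i..a i + exp (- l i)};
          y \<in> {a j..a j + exp (- l j)}\<rbrakk> \<Longrightarrow> g \<le> \<bar>x - y\<bar>"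
begin

definition X :: "nat \<Rightarrow> real set" where "X i = {a i..a i + exp (- l i)}"

definition f :: "nat \<Rightarrow> real \<Rightarrow> real" where "f i x = exp (l i) * (x - a i)"

abbreviation "T \<equiv> pl_map n X f"

abbreviation "\<Lambda> \<equiv> repeller n X f"

definition itin :: "real \<Rightarrow> nat \<Rightarrow> nat" where "itin x k = branch_at n X ((T ^^ k) x)"

text \<open>The Birkhoff sum of the logarithm of the slope. It reads only the first \<open>m\<close>
  digits, so it serves finite words and infinite sequences alike.\<close>

definition S :: "nat \<Rightarrow> (nat \<Rightarrow> nat) \<Rightarrow> real" where "S m \<omega> = (\<Sum>k<m. l (\<omega> k))"

definition pressure :: "real \<Rightarrow> real" where "pressure t = ln (\<Sum>i=1..n. exp (t * l i))"

lemma S_cong: "(\<And>k. k < m \<Longrightarrow> \<omega> k = \<omega>' k) \<Longrightarrow> S m \<omega> = S m \<omega>'"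
  by (simp add: S_def)

lemma exp_pressure: "exp (pressure t) = (\<Sum>i=1..n. exp (t * l i))"
proof -
  have "0 < (\<Sum>i=1..n. exp (t * l i))" using n_pos by (intro sum_pos) auto
  then show ?thesis by (simp add: pressure_def)
qed

lemma slope_X: "slope X i = exp (l i)"
  by (simp add: slope_def X_def exp_minus divide_simps)

lemma X_subset: "i \<in> {1..n} \<Longrightarrow> X i \<subseteq> {0..1}"
  using a_nonneg[of i] a_le[of i] by (auto simp: X_def)

text \<open>A point in two different branch intervals would have distance 0 to itself, below the
  gap; hence the \<open>LEAST\<close> in \<open>branch_at\<close> has only one candidate.\<close>

lemma branch_at_eq:
  assumes "i \<in> {1..n}" "x \<in> X i"
  shows "branch_at n X x = i"
proof -
  have *: "j = i" if "j \<in> {1..n}" "x \<in> X j" for j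
    using separated[of i j x x] g_pos assms that by (auto simp: X_def)
  show ?thesis unfolding branch_at_def
    by (rule Least_equality) (use assms * in \<open>blast intro: eq_refl[OF sym]\<close>)+
qed

lemma f_bij: "f i ` X i = {0..1}"
proof -
  have "y \<in> f i ` X i" if "y \<in> {0..1}" for y
  proof (rule image_eqI)
    show "y = f i (a i + exp (- l i) * y)"
      by (simp add: f_def exp_minus)
    show "a i + exp (- l i) * y \<in> X i"
      using that by (auto simp: X_def mult_le_cancel_left2)
  qed
  moreover have "f i x \<in> {0..1}" if "x \<in> X i" for x
  proof -
    have "exp (l i) * (x - a i) \<le> exp (l i) * exp (- l i)"
      using that by (intro mult_left_mono) (auto simp: X_def)
    then show ?thesis using that by (auto simp: X_def f_def mult_exp_exp)
  qed
  ultimately show ?thesis by blast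
qed

lemma pl_expanding_map:
  assumes "\<And>i j. \<lbrakk>i \<in> {1..n}; j \<in> {1..n}; i \<le> j\<rbrakk> \<Longrightarrow> l i \<le> l j"
  shows "pl_expanding_map n X f"
  unfolding pl_expanding_map_def
proof (intro conjI ballI impI)
  fix i assume i: "i \<in> {1..n}"
  show "\<exists>a b. a < b \<and> X i = {a..b}" by (auto simp: X_def intro!: exI)
  show "X i \<subseteq> {0..1}" using X_subset[OF i] .
  show "f i ` X i = {0..1}" by (rule f_bij)
  show "1 < slope X i" using l_pos[OF i] by (simp add: slope_X)
  show "\<exists>c d. \<bar>c\<bar> = slope X i \<and> (\<forall>x\<in>X i. f i x = c * x + d)"
    by (rule exI[of _ "exp (l i)"], rule exI[of _ "- exp (l i) * a i"])
       (auto simp: slope_X f_def algebra_simps)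
next
  fix i j assume ij: "i \<in> {1..n}" "j \<in> {1..n}"
  show "interior (X i) \<inter> interior (X j) = {}" if "i \<noteq> j"
    using branch_at_eq ij that interior_subset by blast
  show "slope X i \<le> slope X j" if "i \<le> j" using assms[OF ij that] by (simp add: slope_X)
qed

lemma repeller_iff: "x \<in> \<Lambda> \<longleftrightarrow> (\<forall>k. \<exists>i\<in>{1..n}. (T ^^ k) x \<in> X i)"
  by (auto simp: repeller_def pl_domain_def)

lemma itin_in: "x \<in> \<Lambda> \<Longrightarrow> itin x k \<in> {1..n}"
  using repeller_iff branch_at_eq unfolding itin_def by metis

lemma orbit_in: "x \<in> \<Lambda> \<Longrightarrow> (T ^^ k) x \<in> X (itin x k)"
  using repeller_iff branch_at_eq unfolding itin_def by metis

lemma orbit_unit: "x \<in> \<Lambda> \<Longrightarrow> (T ^^ k) x \<in> {0..1}"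
  using orbit_in itin_in X_subset by blast

lemma repeller_bounded: "bounded \<Lambda>"
  using orbit_unit[of _ 0] by (intro bounded_subset[OF bounded_closed_interval[of 0 1]]) auto

lemma orbit_Suc: "(T ^^ Suc k) x = exp (l (itin x k)) * ((T ^^ k) x - a (itin x k))"
  by (simp add: pl_map_def itin_def f_def)

text \<open>Along a common itinerary both orbits are expanded by the same affine branch at each
  step, so the distance is multiplied by \<open>exp (S m (itin x))\<close> in total.\<close>

lemma orbit_dist:
  assumes "\<And>k. k < m \<Longrightarrow> itin x k = itin y k"
  shows "\<bar>x - y\<bar> = exp (- S m (itin x)) * \<bar>(T ^^ m) x - (T ^^ m) y\<bar>"
  using assms
proof (induction m)
  case 0
  then show ?case by (simp add: S_def)
next
  case (Suc m)
  have eq: "itin x m = itin y m" using Suc.prems by simp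
  have "\<bar>(T ^^ Suc m) x - (T ^^ Suc m) y\<bar> = exp (l (itin x m)) * \<bar>(T ^^ m) x - (T ^^ m) y\<bar>"
    unfolding orbit_Suc eq by (simp add: abs_mult flip: right_diff_distrib)
  moreover have "exp (- S (Suc m) (itin x)) = exp (- S m (itin x)) / exp (l (itin x m))"
    by (simp add: S_def exp_diff)
  ultimately show ?case using Suc by simp
qed

lemma dist_le:
  assumes "x \<in> \<Lambda>" "y \<in> \<Lambda>" "\<And>k. k < m \<Longrightarrow> itin x k = itin y k"
  shows "\<bar>x - y\<bar> \<le> exp (- S m (itin x))"
proof -
  have "\<bar>(T ^^ m) x - (T ^^ m) y\<bar> \<le> 1"
    using orbit_unit[OF assms(1), of m] orbit_unit[OF assms(2), of m] by auto
  moreover have "\<bar>x - y\<bar> = exp (- S m (itin x)) * \<bar>(T ^^ m) x - (T ^^ m) y\<bar>"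
    using assms(3) by (rule orbit_dist)
  ultimately show ?thesis by (simp add: mult_left_le)
qed

text \<open>After \<open>m\<close> common steps the images lie in different branch intervals and so
  are at least \<open>g\<close> apart; \<open>orbit_dist\<close> pulls this back. It is the only
  place where the size of the gap enters a metric estimate.\<close>

lemma dist_ge:
  assumes "x \<in> \<Lambda>" "y \<in> \<Lambda>" "\<And>k. k < m \<Longrightarrow> itin x k = itin y k" "itin x m \<noteq> itin y m"
  shows "g * exp (- S m (itin x)) \<le> \<bar>x - y\<bar>"
proof -
  have "g \<le> \<bar>(T ^^ m) x - (T ^^ m) y\<bar>"
    using separated[OF itin_in[OF assms(1)] itin_in[OF assms(2)] assms(4)]
      orbit_in[OF assms(1), of m] orbit_in[OF assms(2), of m] by (auto simp: X_def)
  moreover have "\<bar>x - y\<bar> = exp (- S m (itin x)) * \<bar>(T ^^ m) x - (T ^^ m) y\<bar>"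
    using assms(3) by (rule orbit_dist)
  ultimately show ?thesis by simp
qed

section \<open>Growth of Birkhoff sums, words and cylinders\<close>

definition lmin :: real where "lmin = Min (l ` {1..n})"

definition lmax :: real where "lmax = Max (l ` {1..n})"

lemma lmin_pos: "0 < lmin"
  unfolding lmin_def using n_pos l_pos by (subst Min_gr_iff) auto

lemma lmin_le: "i \<in> {1..n} \<Longrightarrow> lmin \<le> l i"
  unfolding lmin_def by (intro Min_le) auto

lemma le_lmax: "i \<in> {1..n} \<Longrightarrow> l i \<le> lmax"
  unfolding lmax_def by (intro Max_ge) auto

lemma S_ge: "(\<And>k. k < m \<Longrightarrow> \<omega> k \<in> {1..n}) \<Longrightarrow> real m * lmin \<le> S m \<omega>"
  unfolding S_def using sum_bounded_below[of "{..<m}" lmin "\<lambda>k. l (\<omega> k)"] lmin_le by auto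

lemma S_le: "(\<And>k. k < m \<Longrightarrow> \<omega> k \<in> {1..n}) \<Longrightarrow> S m \<omega> \<le> real m * lmax"
  unfolding S_def using sum_bounded_above[of "{..<m}" "\<lambda>k. l (\<omega> k)" lmax] le_lmax by auto

lemma S_mono: "\<lbrakk>\<And>k. \<omega> k \<in> {1..n}; m \<le> m'\<rbrakk> \<Longrightarrow> S m \<omega> \<le> S m' \<omega>"
  unfolding S_def using l_pos by (intro sum_mono2) (auto intro: less_imp_le)

lemma has_lyapunov_exponent_iff:
  "has_lyapunov_exponent n X f x \<alpha> \<longleftrightarrow> (\<lambda>m. S m (itin x) / real m) \<longlonglongrightarrow> \<alpha>"
proof -
  have "ln (abs_deriv_iterate n X f m x) = S m (itin x)" for m
    unfolding abs_deriv_iterate_def S_def slope_X itin_def by (subst ln_prod) auto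
  then show ?thesis by (simp add: has_lyapunov_exponent_def)
qed

definition level_set :: "real \<Rightarrow> real set" where
  "level_set \<alpha> = {x \<in> \<Lambda>. has_lyapunov_exponent n X f x \<alpha>}"

definition words :: "nat \<Rightarrow> (nat \<Rightarrow> nat) set" where "words m = {..<m} \<rightarrow>\<^sub>E {1..n}"

lemma words_nth: "\<lbrakk>w \<in> words m; k < m\<rbrakk> \<Longrightarrow> w k \<in> {1..n}"
  using PiE_mem[of w "{..<m}" "\<lambda>_. {1..n}" k] by (simp add: words_def)

lemma finite_words: "finite (words m)"
  unfolding words_def by (intro finite_PiE) auto

text \<open>The Birkhoff sum is additive over the digits, which range independently over the
  branches, so the partition function of length \<open>m\<close> is the \<open>m\<close>-th power of
  that of length 1.\<close>

lemma sum_words: "(\<Sum>w\<in>words m. exp (t * S m w)) = exp (real m * pressure t)"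
proof -
  have "exp (real m * pressure t) = (\<Prod>k<m. \<Sum>i=1..n. exp (t * l i))"
    by (simp add: exp_of_nat_mult exp_pressure)
  also have "\<dots> = (\<Sum>w\<in>words m. \<Prod>k<m. exp (t * l (w k)))"
    unfolding words_def by (rule prod_sum_PiE) auto
  also have "\<dots> = (\<Sum>w\<in>words m. exp (t * S m w))"
    by (simp add: S_def exp_sum sum_distrib_left)
  finally show ?thesis by simp
qed

text \<open>Restricted to the repeller, since itineraries have a meaning only there.\<close>

definition cyl :: "nat \<Rightarrow> (nat \<Rightarrow> nat) \<Rightarrow> real set" where
  "cyl m w = {x \<in> \<Lambda>. \<forall>k<m. itin x k = w k}"

lemma bounded_cyl: "bounded (cyl m w)"
  using repeller_bounded by (rule bounded_subset) (auto simp: cyl_def)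

lemma diameter_cyl: "diameter (cyl m w) \<le> exp (- S m w)"
proof (rule diameter_le)
  fix x y assume xy: "x \<in> cyl m w" "y \<in> cyl m w"
  have "S m (itin x) = S m w" using xy by (intro S_cong) (auto simp: cyl_def)
  then show "norm (x - y) \<le> exp (- S m w)"
    using xy dist_le[of x y m] by (auto simp: cyl_def)
qed simp

subsection \<open>Hausdorff dimension of the level sets\<close>

text \<open>The cylinders whose Birkhoff average is close to \<open>\<alpha>\<close> cover the level
  set at all large lengths. On them \<open>exp (- s * S m w)\<close> is dominated by
  \<open>exp (t * S m w)\<close> times a factor that beats the partition function, so the total cost
  at length \<open>m\<close> decays geometrically.\<close>

lemma hausdorff_measure_level_set_eq_0:
  assumes s: "0 < s" and "pressure t < (s + t) * \<alpha>"
  shows "hausdorff_measure s (level_set \<alpha>) = 0"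
proof -
  \<comment> \<open>\<open>D\<close> is the slack in the hypothesis. Half of it becomes the decay
    rate \<open>\<eta>\<close>; the other half absorbs the error \<open>\<epsilon>\<close> of the
    Birkhoff average. The \<open>+ 1\<close> in \<open>c\<close> covers the case
    \<open>s + t = 0\<close>.\<close>
  define D c where "D = (s + t) * \<alpha> - pressure t" and "c = \<bar>s + t\<bar> + 1"
  define \<epsilon> \<eta> where "\<epsilon> = D / (2 * c)" and "\<eta> = D / 2"
  have D: "0 < D" and c: "0 < c" using assms by (auto simp: D_def c_def)
  have \<epsilon>: "0 < \<epsilon>" and \<eta>: "0 < \<eta>" using D c by (auto simp: \<epsilon>_def \<eta>_def)
  have \<epsilon>\<eta>: "pressure t + \<eta> \<le> (s + t) * \<alpha> - \<bar>s + t\<bar> * \<epsilon>"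
  proof -
    have "\<bar>s + t\<bar> * \<epsilon> \<le> c * \<epsilon>" using \<epsilon> by (intro mult_right_mono) (auto simp: c_def)
    also have "\<dots> = \<eta>" using c by (simp add: \<epsilon>_def \<eta>_def)
    finally have "\<bar>s + t\<bar> * \<epsilon> \<le> \<eta>" .
    moreover have "pressure t + D = (s + t) * \<alpha>" "2 * \<eta> = D" by (simp_all add: \<eta>_def D_def)
    ultimately show ?thesis by linarith
  qed
  define B where "B m = {w \<in> words m. \<bar>S m w - real m * \<alpha>\<bar> \<le> real m * \<epsilon>}" for m
  have finB: "finite (B m)" for m using finite_words by (simp add: B_def)
  have sumB: "(\<Sum>w\<in>B m. exp (- s * S m w)) \<le> exp (- \<eta>) ^ m" for m
  proof -
    have "exp (- s * S m w) \<le> exp (t * S m w) * exp (- (real m * (pressure t + \<eta>)))"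
      if "w \<in> B m" for w
    proof -
      have "\<bar>S m w - real m * \<alpha>\<bar> \<le> real m * \<epsilon>" using that by (simp add: B_def)
      then have "\<bar>(s + t) * (S m w - real m * \<alpha>)\<bar> \<le> \<bar>s + t\<bar> * (real m * \<epsilon>)"
        by (simp add: abs_mult mult_left_mono)
      then have "(s + t) * S m w \<ge> real m * ((s + t) * \<alpha> - \<bar>s + t\<bar> * \<epsilon>)"
        by (simp add: algebra_simps)
      moreover have "real m * ((s + t) * \<alpha> - \<bar>s + t\<bar> * \<epsilon>) \<ge> real m * (pressure t + \<eta>)"
        using \<epsilon>\<eta> by (intro mult_left_mono) auto
      ultimately show ?thesis unfolding mult_exp_exp exp_le_cancel_iff by (simp add: algebra_simps)
    qed
    then have "(\<Sum>w\<in>B m. exp (- s * S m w)) \<le> (\<Sum>w\<in>B m. exp (t * S m w) * exp (- (real m * (pressure t + \<eta>))))"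
      by (intro sum_mono)
    also have "\<dots> \<le> (\<Sum>w\<in>words m. exp (t * S m w) * exp (- (real m * (pressure t + \<eta>))))"
      using finite_words by (intro sum_mono2) (auto simp: B_def)
    also have "\<dots> = exp (real m * (- \<eta>))"
      by (simp only: sum_distrib_right[symmetric] sum_words) (simp add: mult_exp_exp algebra_simps)
    finally show ?thesis by (simp only: exp_of_nat_mult)
  qed
  have "hausdorff_content \<delta> s (level_set \<alpha>) \<le> 0" if \<delta>: "0 < \<delta>" for \<delta>
  proof (rule ennreal_le_epsilon)
    fix e :: real assume e: "0 < e"
    define q where "q = exp (- \<eta>)"
    have q: "0 < q" "q < 1" using \<eta> by (auto simp: q_def)
    have "(\<lambda>M. q ^ M / (1 - q)) \<longlonglongrightarrow> 0 / (1 - q)"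
      using q by (intro tendsto_intros LIMSEQ_power_zero) auto
    then have "\<forall>\<^sub>F M in sequentially. q ^ M / (1 - q) < e" using e by (intro order_tendstoD) auto
    moreover have "(\<lambda>M. exp (- lmin) ^ M) \<longlonglongrightarrow> 0"
      using lmin_pos by (intro LIMSEQ_power_zero) auto
    then have "\<forall>\<^sub>F M in sequentially. exp (- lmin) ^ M < \<delta>" using \<delta> by (intro order_tendstoD) auto
    ultimately have "\<forall>\<^sub>F M in sequentially. q ^ M / (1 - q) < e \<and> exp (- lmin) ^ M < \<delta>"
      by eventually_elim auto
    \<comment> \<open>The first condition makes the geometric tail cheaper than \<open>e\<close>,
      the second makes all cylinders of length at least \<open>M\<close> smaller than
      \<open>\<delta>\<close>.\<close>
    then obtain M where M: "q ^ M / (1 - q) < e" "exp (- lmin) ^ M < \<delta>"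
      using eventually_happens'[OF sequentially_bot] by blast
    define I where "I = (SIGMA m:UNIV. B (M + m))"
    have cover: "level_set \<alpha> \<subseteq> (\<Union>p\<in>I. cyl (M + fst p) (snd p))"
    proof
      fix x assume x: "x \<in> level_set \<alpha>"
      have "(\<lambda>m. S m (itin x) / real m) \<longlonglongrightarrow> \<alpha>"
        using x by (simp add: level_set_def has_lyapunov_exponent_iff)
      then have "\<forall>\<^sub>F m in sequentially. dist (S m (itin x) / real m) \<alpha> < \<epsilon>"
        using \<epsilon> by (rule tendstoD)
      then have "\<forall>\<^sub>F m in sequentially. M < m \<and> dist (S m (itin x) / real m) \<alpha> < \<epsilon>"
        using eventually_gt_at_top[of M] by eventually_elim auto
      then obtain m where m: "M < m" "dist (S m (itin x) / real m) \<alpha> < \<epsilon>"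
        using eventually_happens'[OF sequentially_bot] by blast
      \<comment> \<open>A single good length beyond \<open>M\<close> suffices for each point,
        because the cover contains the good words of every length from \<open>M\<close> on.\<close>
      define w where "w = restrict (itin x) {..<m}"
      have Sw: "S m w = S m (itin x)" by (rule S_cong) (auto simp: w_def)
      have "\<bar>S m w - real m * \<alpha>\<bar> = real m * dist (S m (itin x) / real m) \<alpha>"
        using m(1) by (simp add: dist_real_def Sw abs_if field_simps)
      also have "\<dots> \<le> real m * \<epsilon>" using m(2) by (intro mult_left_mono) auto
      finally have "w \<in> B m" using x itin_in unfolding B_def words_def w_def level_set_def by auto
      moreover have "x \<in> cyl m w" using x by (auto simp: cyl_def level_set_def w_def)
      ultimately show "x \<in> (\<Union>p\<in>I. cyl (M + fst p) (snd p))"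
        using m(1) by (intro UN_I[of "(m - M, w)"]) (auto simp: I_def)
    qed
    have small: "diameter (cyl (M + m) w) \<le> \<delta>" if "w \<in> B (M + m)" for m w
    proof -
      have "real M * lmin \<le> real (M + m) * lmin" using lmin_pos by (intro mult_right_mono) auto
      also have "\<dots> \<le> S (M + m) w" using that words_nth unfolding B_def by (intro S_ge) blast
      finally have "exp (- S (M + m) w) \<le> exp (real M * (- lmin))" by simp
      also have "\<dots> = exp (- lmin) ^ M" by (rule exp_of_nat_mult)
      finally show ?thesis using diameter_cyl[of "M + m" w] M by simp
    qed
    have "hausdorff_content \<delta> s (level_set \<alpha>)
        \<le> (\<integral>\<^sup>+p. ennreal (diameter (cyl (M + fst p) (snd p)) powr s) \<partial>count_space I)"
    proof (rule hausdorff_content_countable_cover_le)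
      show "countable I" unfolding I_def using finB by (intro countable_SIGMA countable_finite[OF finB]) auto
      show "0 \<le> \<delta>" using \<delta> by simp
      show "level_set \<alpha> \<subseteq> (\<Union>p\<in>I. cyl (M + fst p) (snd p))" by (rule cover)
      show "bounded (cyl (M + fst p) (snd p)) \<and> diameter (cyl (M + fst p) (snd p)) \<le> \<delta>"
        if "p \<in> I" for p
        using that small bounded_cyl by (cases p) (simp add: I_def)
    qed
    also have "\<dots> = (\<Sum>m. \<Sum>w\<in>B (M + m). ennreal (diameter (cyl (M + m) w) powr s))"
      unfolding I_def by (subst nn_integral_count_space_Sigma_finite) (auto simp: finB)
    also have "\<dots> \<le> (\<Sum>m. ennreal (q ^ (M + m)))"
    proof (intro suminf_le)
      fix m
      have "(\<Sum>w\<in>B (M + m). diameter (cyl (M + m) w) powr s) \<le> (\<Sum>w\<in>B (M + m). exp (- s * S (M + m) w))"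
      proof (intro sum_mono)
        fix w
        have "diameter (cyl (M + m) w) powr s \<le> exp (- S (M + m) w) powr s"
          using s diameter_cyl diameter_ge_0[OF bounded_cyl] by (intro powr_mono2) auto
        then show "diameter (cyl (M + m) w) powr s \<le> exp (- s * S (M + m) w)"
          by (simp add: powr_def)
      qed
      also have "\<dots> \<le> q ^ (M + m)" using sumB by (simp add: q_def)
      finally show "(\<Sum>w\<in>B (M + m). ennreal (diameter (cyl (M + m) w) powr s)) \<le> ennreal (q ^ (M + m))"
        by (simp add: sum_ennreal ennreal_leI)
    qed auto
    also have "\<dots> = ennreal (q ^ M * (1 / (1 - q)))"
    proof -
      have "(\<lambda>m. q ^ M * q ^ m) sums (q ^ M * (1 / (1 - q)))"
        using q by (intro sums_mult geometric_sums) auto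
      then show ?thesis using q by (intro suminf_ennreal_eq) (auto simp: power_add)
    qed
    also have "\<dots> \<le> ennreal e" using M(1) by (intro ennreal_leI) simp
    finally show "hausdorff_content \<delta> s (level_set \<alpha>) \<le> 0 + ennreal e" by simp
  qed
  then show ?thesis unfolding hausdorff_measure_def by (auto intro!: antisym SUP_least)
qed

section \<open>The coding map\<close>

text \<open>The point with itinerary \<open>\<omega>\<close>, obtained by iterating the inverse
  branches \<open>x = a i + exp (- l i) * y\<close>.\<close>

definition code :: "(nat \<Rightarrow> nat) \<Rightarrow> real" where
  "code \<omega> = (\<Sum>k. a (\<omega> k) * exp (- S k \<omega>))"

text \<open>The left side is the right endpoint of the interval reached after \<open>m\<close>
  inverse branches, and these intervals are nested in the unit interval. Both summability and
  \<open>code_unit\<close> follow.\<close>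

lemma code_partial_le:
  assumes "\<And>k. \<omega> k \<in> {1..n}"
  shows "(\<Sum>k<m. a (\<omega> k) * exp (- S k \<omega>)) + exp (- S m \<omega>) \<le> 1"
proof (induction m)
  case 0
  then show ?case by (simp add: S_def)
next
  case (Suc m)
  have "exp (- S (Suc m) \<omega>) = exp (- S m \<omega>) * exp (- l (\<omega> m))"
    by (simp add: S_def mult_exp_exp)
  then have "a (\<omega> m) * exp (- S m \<omega>) + exp (- S (Suc m) \<omega>) = (a (\<omega> m) + exp (- l (\<omega> m))) * exp (- S m \<omega>)"
    by (simp add: algebra_simps)
  also have "\<dots> \<le> 1 * exp (- S m \<omega>)"
    using a_le[OF assms] by (intro mult_right_mono) auto
  finally show ?case using Suc.IH by simp
qed

lemma code_term_nonneg: "(\<And>k. \<omega> k \<in> {1..n}) \<Longrightarrow> 0 \<le> a (\<omega> k) * exp (- S k \<omega>)"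
  using a_nonneg by simp

lemma code_summable:
  assumes "\<And>k. \<omega> k \<in> {1..n}"
  shows "summable (\<lambda>k. a (\<omega> k) * exp (- S k \<omega>))"
proof (rule summableI_nonneg_bounded)
  show "0 \<le> a (\<omega> k) * exp (- S k \<omega>)" for k using assms by (rule code_term_nonneg)
  show "(\<Sum>k<m. a (\<omega> k) * exp (- S k \<omega>)) \<le> 1" for m
    using code_partial_le[of \<omega> m] assms exp_ge_zero[of "- S m \<omega>"] by (simp del: exp_ge_zero)
qed

lemma code_unit:
  assumes "\<And>k. \<omega> k \<in> {1..n}"
  shows "code \<omega> \<in> {0..1}"
proof -
  have "(\<Sum>k<m. a (\<omega> k) * exp (- S k \<omega>)) \<le> 1" for m
    using code_partial_le[of \<omega> m] assms exp_ge_zero[of "- S m \<omega>"] by (simp del: exp_ge_zero)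
  then have "code \<omega> \<le> 1"
    unfolding code_def using code_summable[of \<omega>] assms by (intro suminf_le_const) auto
  moreover have "0 \<le> code \<omega>"
    unfolding code_def using assms by (intro suminf_nonneg code_summable code_term_nonneg)
  ultimately show ?thesis by simp
qed

lemma code_shift:
  assumes "\<And>k. \<omega> k \<in> {1..n}"
  shows "code \<omega> = a (\<omega> 0) + exp (- l (\<omega> 0)) * code (\<lambda>k. \<omega> (Suc k))"
proof -
  have S_Suc: "S (Suc k) \<omega> = l (\<omega> 0) + S k (\<lambda>k. \<omega> (Suc k))" for k
    unfolding S_def by (subst sum.lessThan_Suc_shift) simp
  have "code \<omega> = a (\<omega> 0) * exp (- S 0 \<omega>) + (\<Sum>k. a (\<omega> (Suc k)) * exp (- S (Suc k) \<omega>))"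
    unfolding code_def using suminf_split_head[OF code_summable[of \<omega>]] assms by simp
  also have "(\<Sum>k. a (\<omega> (Suc k)) * exp (- S (Suc k) \<omega>))
      = (\<Sum>k. exp (- l (\<omega> 0)) * (a (\<omega> (Suc k)) * exp (- S k (\<lambda>k. \<omega> (Suc k)))))"
    unfolding S_Suc by (simp add: exp_diff exp_minus field_simps)
  also have "\<dots> = exp (- l (\<omega> 0)) * code (\<lambda>k. \<omega> (Suc k))"
    unfolding code_def using assms by (intro suminf_mult code_summable)
  finally show ?thesis by (simp add: S_def)
qed

text \<open>By \<open>code_shift\<close> the code is the image of the shifted code under an inverse
  branch, so \<open>code\<close> conjugates the shift to the map.\<close>

lemma orbit_code:
  assumes "\<And>k. \<omega> k \<in> {1..n}"
  shows "code \<omega> \<in> X (\<omega> 0)" and "T (code \<omega>) = code (\<lambda>k. \<omega> (Suc k))"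
proof -
  have u: "code (\<lambda>k. \<omega> (Suc k)) \<in> {0..1}" using assms by (intro code_unit)
  show X: "code \<omega> \<in> X (\<omega> 0)"
    unfolding code_shift[of \<omega>, OF assms] X_def using u by (auto simp: mult_left_le)
  have "branch_at n X (code \<omega>) = \<omega> 0" using assms X by (rule branch_at_eq)
  then show "T (code \<omega>) = code (\<lambda>k. \<omega> (Suc k))"
    unfolding pl_map_def f_def by (subst code_shift[of \<omega>, OF assms]) (simp_all add: exp_minus)
qed

lemma orbit_code_funpow:
  assumes "\<And>k. \<omega> k \<in> {1..n}"
  shows "(T ^^ m) (code \<omega>) = code (\<lambda>k. \<omega> (m + k))"
proof (induction m)
  case (Suc m)
  then show ?case using orbit_code(2)[of "\<lambda>k. \<omega> (m + k)"] assms by simp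
qed simp

lemma code_in_repeller: "(\<And>k. \<omega> k \<in> {1..n}) \<Longrightarrow> code \<omega> \<in> \<Lambda>"
  unfolding repeller_iff using orbit_code_funpow orbit_code(1)[of "\<lambda>k. \<omega> (m + k)" for m]
  by metis

lemma itin_code:
  assumes "\<And>k. \<omega> k \<in> {1..n}"
  shows "itin (code \<omega>) = \<omega>"
proof
  fix m
  have "code (\<lambda>k. \<omega> (m + k)) \<in> X (\<omega> m)" using orbit_code(1)[of "\<lambda>k. \<omega> (m + k)"] assms by simp
  then show "itin (code \<omega>) m = \<omega> m"
    unfolding itin_def using assms by (subst orbit_code_funpow) (auto intro!: branch_at_eq)
qed

section \<open>Bernoulli measures\<close>

text \<open>Subtracting the pressure normalizes the weights. The product measure is the Gibbs
  measure of \<open>t\<close> times the logarithm of the slope.\<close>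

definition weights :: "real \<Rightarrow> nat measure" where
  "weights t = point_measure {1..n} (\<lambda>i. ennreal (exp (t * l i - pressure t)))"

definition bernoulli :: "real \<Rightarrow> (nat \<Rightarrow> nat) measure" where
  "bernoulli t = (\<Pi>\<^sub>M k\<in>UNIV. weights t)"

lemma emeasure_weights:
  "A \<subseteq> {1..n} \<Longrightarrow> emeasure (weights t) A = ennreal (\<Sum>i\<in>A. exp (t * l i - pressure t))"
  unfolding weights_def by (subst emeasure_point_measure_finite) (auto simp: sum_ennreal)

lemma sets_weights: "sets (weights t) = Pow {1..n}"
  by (simp add: weights_def sets_point_measure)

lemma space_weights: "space (weights t) = {1..n}"
  by (simp add: weights_def space_point_measure)

lemma prob_space_weights: "prob_space (weights t)"
proof
  have "(\<Sum>i=1..n. exp (t * l i - pressure t)) = (\<Sum>i=1..n. exp (t * l i)) / exp (pressure t)"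
    by (simp add: exp_diff sum_divide_distrib)
  also have "\<dots> = 1" unfolding exp_pressure[symmetric] by simp
  finally show "emeasure (weights t) (space (weights t)) = 1"
    by (simp add: space_weights emeasure_weights)
qed

lemma product_prob_space_weights: "product_prob_space (\<lambda>_. weights t)"
  using prob_space_weights by (rule product_prob_spaceI)

lemma space_bernoulli: "\<omega> \<in> space (bernoulli t) \<longleftrightarrow> (\<forall>k. \<omega> k \<in> {1..n})"
  unfolding bernoulli_def by (auto simp: space_PiM space_weights PiE_def)

lemma prob_space_bernoulli: "prob_space (bernoulli t)"
  unfolding bernoulli_def by (rule prob_space_PiM) (rule prob_space_weights)

definition cyls :: "real \<Rightarrow> nat \<Rightarrow> (nat \<Rightarrow> nat) \<Rightarrow> (nat \<Rightarrow> nat) set" where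
  "cyls t m w = {\<omega> \<in> space (bernoulli t). \<forall>k<m. \<omega> k = w k}"

text \<open>\<open>weights t\<close> carries the full power set of the branches, so every function
  of one coordinate is measurable.\<close>

lemma measurable_coord: "(\<lambda>\<omega>. h (\<omega> k)) \<in> borel_measurable (bernoulli t)"
  for h :: "nat \<Rightarrow> 'c::topological_space"
proof -
  have "(\<lambda>\<omega>. \<omega> k) \<in> measurable (bernoulli t) (weights t)"
    unfolding bernoulli_def by (rule measurable_component_singleton) simp
  moreover have "h \<in> borel_measurable (weights t)"
    by (auto simp: measurable_def sets_weights space_weights)
  ultimately show ?thesis by (rule measurable_compose)
qed

lemma measurable_S [measurable]: "S m \<in> borel_measurable (bernoulli t)"
  unfolding S_def[abs_def] by (intro borel_measurable_sum measurable_coord)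

lemma cyls_sets: "cyls t m w \<in> sets (bernoulli t)"
proof -
  have [measurable]: "(\<lambda>\<omega>. real (\<omega> k)) \<in> borel_measurable (bernoulli t)" for k
    by (rule measurable_coord)
  have "cyls t m w = {\<omega> \<in> space (bernoulli t). \<forall>k<m. real (\<omega> k) = real (w k)}"
    by (auto simp: cyls_def)
  also have "\<dots> \<in> sets (bernoulli t)" by measurable
  finally show ?thesis .
qed

text \<open>The Gibbs property, here with equality: the logarithms of the independent weights add up
  to a Birkhoff sum.\<close>

lemma emeasure_cyls:
  assumes "\<And>k. k < m \<Longrightarrow> w k \<in> {1..n}"
  shows "emeasure (bernoulli t) (cyls t m w) = ennreal (exp (t * S m w - real m * pressure t))"
proof -
  interpret product_prob_space "\<lambda>_::nat. weights t" UNIV by (rule product_prob_space_weights)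
  have "emeasure (bernoulli t) (cyls t m w)
      = emeasure (\<Pi>\<^sub>M k\<in>UNIV. weights t) {\<omega> \<in> space (\<Pi>\<^sub>M k\<in>UNIV. weights t). \<forall>k\<in>{..<m}. \<omega> k \<in> {w k}}"
    by (simp add: cyls_def bernoulli_def Ball_def)
  also have "\<dots> = (\<Prod>k<m. emeasure (weights t) {w k})"
    using assms by (intro emeasure_PiM_Collect[where J = "{..<m}" and X = "\<lambda>k. {w k}"]) (auto simp: sets_weights)
  also have "\<dots> = (\<Prod>k<m. ennreal (exp (t * l (w k) - pressure t)))"
    using assms by (intro prod.cong) (auto simp: emeasure_weights)
  also have "\<dots> = ennreal (\<Prod>k<m. exp (t * l (w k) - pressure t))"
    by (intro prod_ennreal) auto
  also have "(\<Prod>k<m. exp (t * l (w k) - pressure t)) = exp (\<Sum>k<m. t * l (w k) - pressure t)"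
    by (simp add: exp_sum)
  also have "(\<Sum>k<m. t * l (w k) - pressure t) = t * S m w - real m * pressure t"
    by (simp add: S_def sum_subtractf sum_distrib_left)
  finally show ?thesis .
qed

section \<open>Large deviations and the law of large numbers\<close>

text \<open>On the event the factor \<open>exp (h * (S m \<omega> - real m * c))\<close> is at least
  1. Inserting it shifts the parameter from \<open>t\<close> to \<open>t + h\<close>, and
  \<open>sum_words\<close> evaluates the result. Positive \<open>h\<close> treats the upper tail,
  negative \<open>h\<close> the lower.\<close>

lemma chernoff:
  "emeasure (bernoulli t) {\<omega> \<in> space (bernoulli t). 0 \<le> h * (S m \<omega> - real m * c)}
    \<le> ennreal (exp (pressure (t + h) - pressure t - h * c) ^ m)"
proof -
  define B where "B = {w \<in> words m. 0 \<le> h * (S m w - real m * c)}"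
  have finB: "finite B" using finite_words by (simp add: B_def)
  have "\<omega> \<in> (\<Union>w\<in>B. cyls t m w)" if \<omega>: "\<omega> \<in> space (bernoulli t)" "0 \<le> h * (S m \<omega> - real m * c)" for \<omega>
  proof
    have "S m (restrict \<omega> {..<m}) = S m \<omega>" by (rule S_cong) auto
    then show "restrict \<omega> {..<m} \<in> B"
      using \<omega> by (auto simp: B_def words_def space_bernoulli)
    show "\<omega> \<in> cyls t m (restrict \<omega> {..<m})" using \<omega> by (simp add: cyls_def)
  qed
  then have "emeasure (bernoulli t) {\<omega> \<in> space (bernoulli t). 0 \<le> h * (S m \<omega> - real m * c)}
      \<le> emeasure (bernoulli t) (\<Union>w\<in>B. cyls t m w)"
    using finB cyls_sets by (intro emeasure_mono) auto
  also have "\<dots> \<le> (\<Sum>w\<in>B. emeasure (bernoulli t) (cyls t m w))"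
    using finB cyls_sets by (intro emeasure_subadditive_finite) auto
  also have "\<dots> = (\<Sum>w\<in>B. ennreal (exp (t * S m w - real m * pressure t)))"
    by (intro sum.cong refl emeasure_cyls) (use words_nth in \<open>auto simp: B_def\<close>)
  also have "\<dots> = ennreal (\<Sum>w\<in>B. exp (t * S m w - real m * pressure t))"
    by (intro sum_ennreal) auto
  also have "\<dots> \<le> ennreal (exp (pressure (t + h) - pressure t - h * c) ^ m)"
  proof (intro ennreal_leI)
    have "(\<Sum>w\<in>B. exp (t * S m w - real m * pressure t))
        \<le> (\<Sum>w\<in>B. exp ((t + h) * S m w) * exp (- real m * (pressure t + h * c)))"
      by (intro sum_mono) (auto simp: B_def mult_exp_exp algebra_simps)
    also have "\<dots> \<le> (\<Sum>w\<in>words m. exp ((t + h) * S m w) * exp (- real m * (pressure t + h * c)))"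
      using finite_words by (intro sum_mono2) (auto simp: B_def)
    also have "\<dots> = exp (real m * (pressure (t + h) - pressure t - h * c))"
      by (simp only: sum_distrib_right[symmetric] sum_words) (simp add: mult_exp_exp algebra_simps)
    finally show "(\<Sum>w\<in>B. exp (t * S m w - real m * pressure t))
        \<le> exp (pressure (t + h) - pressure t - h * c) ^ m"
      by (simp only: exp_of_nat_mult)
  qed
  finally show ?thesis .
qed

text \<open>The hypothesis makes the Chernoff bounds a convergent geometric series, so
  Borel-Cantelli applies.\<close>

lemma AE_eventually_chernoff:
  assumes "pressure (t + h) - pressure t - h * c < 0"
  shows "AE \<omega> in bernoulli t. \<forall>\<^sub>F m in sequentially. h * (S m \<omega> - real m * c) < 0"
proof -
  interpret prob_space "bernoulli t" by (rule prob_space_bernoulli)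
  define A where "A m = {\<omega> \<in> space (bernoulli t). 0 \<le> h * (S m \<omega> - real m * c)}" for m
  define q where "q = exp (pressure (t + h) - pressure t - h * c)"
  have q: "0 < q" "q < 1" using assms by (auto simp: q_def)
  have le: "measure (bernoulli t) (A m) \<le> q ^ m" for m
    using chernoff[of t h m c] q by (simp add: A_def q_def emeasure_eq_measure)
  have "AE \<omega> in bernoulli t. \<forall>\<^sub>F m in sequentially. \<omega> \<in> space (bernoulli t) - A m"
  proof (rule borel_cantelli_AE1)
    show "A m \<in> sets (bernoulli t)" for m unfolding A_def by measurable
    show "summable (\<lambda>m. measure (bernoulli t) (A m))"
      using q le by (intro summable_comparison_test[OF _ summable_geometric[of q]]) auto
  qed (simp add: less_top[symmetric])
  then show ?thesis
    by eventually_elim (auto simp: A_def elim: eventually_mono)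
qed

text \<open>The exponent in the Chernoff bound vanishes at \<open>h = 0\<close> with slope
  \<open>\<alpha> - c\<close>. Hence it is negative for small positive \<open>h\<close> if
  \<open>c = \<alpha> + \<epsilon>\<close>, and for small negative \<open>h\<close> if
  \<open>c = \<alpha> - \<epsilon>\<close>.\<close>

lemma AE_birkhoff_average:
  assumes "(pressure has_real_derivative \<alpha>) (at t)"
  shows "AE \<omega> in bernoulli t. (\<lambda>m. S m \<omega> / real m) \<longlonglongrightarrow> \<alpha>"
proof -
  have D: "((\<lambda>h. pressure (t + h) - pressure t - h * c) has_real_derivative \<alpha> - c) (at 0)" for c
  proof -
    have "((\<lambda>h. pressure (t + h)) has_real_derivative \<alpha>) (at 0)"
      using assms DERIV_shift[of pressure \<alpha> 0 t] by (simp add: add.commute)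
    then show ?thesis by (auto intro!: derivative_eq_intros)
  qed
  have near: "AE \<omega> in bernoulli t. \<forall>\<^sub>F m in sequentially. \<bar>S m \<omega> - real m * \<alpha>\<bar> < real m * \<epsilon>"
    if \<epsilon>: "0 < \<epsilon>" for \<epsilon>
  proof -
    obtain d where d: "0 < d" "\<And>h. \<lbrakk>0 < h; h < d\<rbrakk> \<Longrightarrow> pressure (t + h) - pressure t - h * (\<alpha> + \<epsilon>) < 0"
      using DERIV_neg_dec_right[OF D[of "\<alpha> + \<epsilon>"]] \<epsilon> by auto
    have 1: "0 < d / 2" "pressure (t + d / 2) - pressure t - d / 2 * (\<alpha> + \<epsilon>) < 0"
      using d(1) by (simp, intro d(2)) auto
    obtain d' where d': "0 < d'" "\<And>h. \<lbrakk>0 < h; h < d'\<rbrakk> \<Longrightarrow> pressure (t - h) - pressure t + h * (\<alpha> - \<epsilon>) < 0"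
      using DERIV_pos_inc_left[OF D[of "\<alpha> - \<epsilon>"]] \<epsilon> by auto
    have 2: "0 < d' / 2" "pressure (t + - (d' / 2)) - pressure t - - (d' / 2) * (\<alpha> - \<epsilon>) < 0"
      using d'(1) d'(2)[of "d' / 2"] by simp_all
    show ?thesis
      using AE_eventually_chernoff[OF 1(2)] AE_eventually_chernoff[OF 2(2)]
    proof eventually_elim
      case (elim \<omega>)
      then show ?case
      proof eventually_elim
        case (elim m)
        have "S m \<omega> - real m * (\<alpha> + \<epsilon>) < 0" "0 < S m \<omega> - real m * (\<alpha> - \<epsilon>)"
          using elim 1(1) 2(1) by (auto simp: mult_less_0_iff zero_less_mult_iff)
        then show ?case by (auto simp: abs_less_iff algebra_simps)
      qed
    qed
  qed
  \<comment> \<open>Only countably many tolerances \<open>1 / Suc j\<close> are used, so the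
    exceptional null sets can be united.\<close>
  have "AE \<omega> in bernoulli t. \<forall>j::nat. \<forall>\<^sub>F m in sequentially. \<bar>S m \<omega> - real m * \<alpha>\<bar> < real m * (1 / Suc j)"
    unfolding AE_all_countable by (intro allI near) simp
  then show ?thesis
  proof eventually_elim
    case (elim \<omega>)
    show ?case
    proof (rule tendstoI)
      fix \<epsilon> :: real assume "0 < \<epsilon>"
      then obtain j :: nat where j: "1 / Suc j < \<epsilon>" using nat_approx_posE by blast
      show "\<forall>\<^sub>F m in sequentially. dist (S m \<omega> / real m) \<alpha> < \<epsilon>"
        using elim[rule_format, of j] eventually_gt_at_top[of 0]
      proof eventually_elim
        case (elim m)
        have "dist (S m \<omega> / real m) \<alpha> = \<bar>S m \<omega> - real m * \<alpha>\<bar> / real m"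
          using elim(2) by (simp add: dist_real_def abs_if field_simps)
        also have "\<dots> < 1 / Suc j" using elim by (simp add: field_simps)
        finally show ?case using j by simp
      qed
    qed
  qed
qed

section \<open>Mass distribution principle and lower bound for the dimension\<close>

text \<open>From length \<open>M\<close> on, a cylinder around \<open>\<omega>\<close> has measure
  at most \<open>exp (- s * S m \<omega>)\<close>, which tends to 0. This settles covering sets that
  contain one code only and may have diameter 0.\<close>

lemma null_cylinder_intersection:
  assumes \<omega>: "\<omega> \<in> space (bernoulli t)" and s: "0 < s"
    and small: "\<And>m. M \<le> m \<Longrightarrow> (s + t) * S m \<omega> \<le> real m * pressure t"
  shows "emeasure (bernoulli t) (\<Inter>m. cyls t m \<omega>) = 0"
proof -
  have \<omega>_in: "\<omega> k \<in> {1..n}" for k using \<omega> by (auto simp: space_bernoulli)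
  have le: "emeasure (bernoulli t) (\<Inter>m. cyls t m \<omega>) \<le> ennreal (exp (- (s * lmin)) ^ m)" if "M \<le> m" for m
  proof -
    have "emeasure (bernoulli t) (\<Inter>m. cyls t m \<omega>) \<le> emeasure (bernoulli t) (cyls t m \<omega>)"
      by (intro emeasure_mono cyls_sets) auto
    also have "\<dots> = ennreal (exp (t * S m \<omega> - real m * pressure t))"
      using \<omega>_in by (intro emeasure_cyls)
    also have "\<dots> \<le> ennreal (exp (real m * (- (s * lmin))))"
    proof (intro ennreal_leI)
      have "s * (real m * lmin) \<le> s * S m \<omega>"
        using s S_ge[of m \<omega>] \<omega>_in by (intro mult_left_mono) auto
      then have "t * S m \<omega> - real m * pressure t \<le> real m * (- (s * lmin))"
        using small[OF that] by (simp add: algebra_simps)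
      then show "exp (t * S m \<omega> - real m * pressure t) \<le> exp (real m * (- (s * lmin)))" by simp
    qed
    finally show ?thesis by (simp only: exp_of_nat_mult)
  qed
  have "(\<lambda>m. ennreal (exp (- (s * lmin)) ^ m)) \<longlonglongrightarrow> ennreal 0"
    using s lmin_pos by (intro tendsto_ennrealI LIMSEQ_power_zero) auto
  then have "emeasure (bernoulli t) (\<Inter>m. cyls t m \<omega>) \<le> ennreal 0"
    using le by (intro LIMSEQ_le_const) auto
  then show ?thesis by simp
qed

text \<open>If two codes in \<open>V\<close> first differ at place \<open>k\<close>, then
  \<open>V\<close> lies in one cylinder of length \<open>k\<close>, whose size is controlled by the
  diameter of \<open>U\<close> through \<open>dist_ge\<close>. A measurable \<open>W\<close> around
  \<open>V\<close> is produced because \<open>V\<close> itself need not be measurable for an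
  arbitrary \<open>U\<close>.\<close>

lemma mass_distribution_cover:
  assumes s: "0 < s" and U: "bounded U" and diam: "diameter U < g * exp (- (real M * lmax))"
    and V: "\<And>\<omega>. \<omega> \<in> V \<Longrightarrow> \<omega> \<in> space (bernoulli t) \<and> code \<omega> \<in> U"
    and small: "\<And>\<omega> m. \<lbrakk>\<omega> \<in> V; M \<le> m\<rbrakk> \<Longrightarrow> (s + t) * S m \<omega> \<le> real m * pressure t"
  shows "\<exists>W\<in>sets (bernoulli t). V \<subseteq> W \<and>
           emeasure (bernoulli t) W \<le> ennreal ((diameter U / g) powr s)"
proof (cases "\<exists>k. \<exists>\<omega>\<in>V. \<exists>\<omega>'\<in>V. \<omega> k \<noteq> \<omega>' k")
  case False
  show ?thesis
  proof (cases "V = {}")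
    case True
    then show ?thesis by (intro bexI[of _ "{}"]) auto
  next
    case nonempty: False
    then obtain \<omega> where \<omega>: "\<omega> \<in> V" by blast
    have "V \<subseteq> (\<Inter>m. cyls t m \<omega>)" using False V \<omega> by (auto simp: cyls_def)
    moreover have "emeasure (bernoulli t) (\<Inter>m. cyls t m \<omega>) = 0"
      using \<omega> V s small by (intro null_cylinder_intersection[of \<omega> t s M]) auto
    moreover have "(\<Inter>m. cyls t m \<omega>) \<in> sets (bernoulli t)"
      using cyls_sets by (intro sets.countable_INT) auto
    ultimately show ?thesis by (intro bexI[of _ "\<Inter>m. cyls t m \<omega>"]) auto
  qed
next
  case True
  define k where "k = (LEAST k. \<exists>\<omega>\<in>V. \<exists>\<omega>'\<in>V. \<omega> k \<noteq> \<omega>' k)"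
  have "\<exists>\<omega>\<in>V. \<exists>\<omega>'\<in>V. \<omega> k \<noteq> \<omega>' k" unfolding k_def using True by (rule LeastI_ex)
  then obtain \<omega> \<omega>' where \<omega>: "\<omega> \<in> V" "\<omega>' \<in> V" "\<omega> k \<noteq> \<omega>' k" by blast
  have agree: "\<omega>1 j = \<omega>2 j" if "j < k" "\<omega>1 \<in> V" "\<omega>2 \<in> V" for j \<omega>1 \<omega>2
    using not_less_Least[OF that(1)[unfolded k_def]] that by blast
  have \<omega>_in: "\<omega> j \<in> {1..n}" "\<omega>' j \<in> {1..n}" for j
    using V \<omega> by (auto simp: space_bernoulli)
  have "g * exp (- S k (itin (code \<omega>))) \<le> \<bar>code \<omega> - code \<omega>'\<bar>"
    using \<omega>_in \<omega> agree by (intro dist_ge code_in_repeller) (simp_all add: itin_code)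
  also have "\<dots> \<le> diameter U"
    using diameter_bounded_bound[OF U] V \<omega> by (simp add: dist_real_def)
  finally have ge: "g * exp (- S k \<omega>) \<le> diameter U"
    using \<omega>_in by (simp add: itin_code)
  \<comment> \<open>For \<open>k < M\<close> the two points would be at least
    \<open>g * exp (- (real M * lmax))\<close> apart, too far for \<open>U\<close>. So
    \<open>small\<close> may be applied at \<open>k\<close>.\<close>
  have "M \<le> k"
  proof (rule ccontr)
    assume "\<not> M \<le> k"
    have "S k \<omega> \<le> S M \<omega>" using \<open>\<not> M \<le> k\<close> \<omega>_in by (intro S_mono) auto
    also have "\<dots> \<le> real M * lmax" using \<omega>_in by (intro S_le)
    finally have "g * exp (- (real M * lmax)) \<le> g * exp (- S k \<omega>)" using g_pos by simp
    then show False using ge diam by simp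
  qed
  have "V \<subseteq> cyls t k \<omega>" using V agree \<omega> by (auto simp: cyls_def)
  moreover have "emeasure (bernoulli t) (cyls t k \<omega>) \<le> ennreal ((diameter U / g) powr s)"
  proof -
    have "emeasure (bernoulli t) (cyls t k \<omega>) = ennreal (exp (t * S k \<omega> - real k * pressure t))"
      using \<omega>_in by (intro emeasure_cyls)
    also have "\<dots> \<le> ennreal (exp (- S k \<omega>) powr s)"
      using small[OF \<omega>(1) \<open>M \<le> k\<close>] by (intro ennreal_leI) (simp add: powr_def algebra_simps)
    also have "\<dots> \<le> ennreal ((diameter U / g) powr s)"
      using ge g_pos s by (intro ennreal_leI powr_mono2) (auto simp: field_simps)
    finally show ?thesis .
  qed
  ultimately show ?thesis using cyls_sets by blast
qed

text \<open>Almost every code has Birkhoff average \<open>\<alpha>\<close>, so its point lies in the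
  level set and its long cylinders satisfy the estimate required by
  \<open>mass_distribution_cover\<close>. Any fine cover then costs at least a fixed multiple of the
  mass of a set of such codes.\<close>

lemma hausdorff_measure_level_set_pos:
  assumes D: "(pressure has_real_derivative \<alpha>) (at t)" and s: "0 < s"
    and lt: "(s + t) * \<alpha> < pressure t"
  shows "0 < hausdorff_measure s (level_set \<alpha>)"
proof -
  interpret prob_space "bernoulli t" by (rule prob_space_bernoulli)
  define G where "G M = {\<omega> \<in> space (bernoulli t). \<forall>m\<ge>M. (s + t) * S m \<omega> \<le> real m * pressure t}" for M
  have G_sets: "G M \<in> sets (bernoulli t)" for M unfolding G_def by measurable
  have conv: "AE \<omega> in bernoulli t. (\<lambda>m. S m \<omega> / real m) \<longlonglongrightarrow> \<alpha>"
    by (rule AE_birkhoff_average[OF D])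
  have "AE \<omega> in bernoulli t. \<exists>M. \<omega> \<in> G M"
    using conv AE_space
  proof eventually_elim
    case (elim \<omega>)
    have "(\<lambda>m. (s + t) * (S m \<omega> / real m)) \<longlonglongrightarrow> (s + t) * \<alpha>"
      by (intro tendsto_intros elim)
    then have "\<forall>\<^sub>F m in sequentially. (s + t) * (S m \<omega> / real m) < pressure t"
      using lt by (rule order_tendstoD)
    then have "\<forall>\<^sub>F m in sequentially. (s + t) * S m \<omega> \<le> real m * pressure t"
      using eventually_gt_at_top[of 0]
      by eventually_elim (simp add: field_simps)
    then show ?case using elim by (auto simp: G_def eventually_sequentially)
  qed
  \<comment> \<open>The sets \<open>G M\<close> cover almost everything and there are countably
    many, so they cannot all be null.\<close>
  have "\<exists>M. emeasure (bernoulli t) (G M) \<noteq> 0"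
  proof (rule ccontr)
    assume "\<not> ?thesis"
    then have "AE \<omega> in bernoulli t. \<forall>M. \<omega> \<notin> G M"
      unfolding AE_all_countable using G_sets by (auto intro!: AE_not_in)
    with \<open>AE \<omega> in bernoulli t. \<exists>M. \<omega> \<in> G M\<close> have "AE \<omega> in bernoulli t. False"
      by eventually_elim auto
    then show False by simp
  qed
  then obtain M where M: "0 < emeasure (bernoulli t) (G M)" by (auto simp: zero_less_iff_neq_zero)
  \<comment> \<open>Halved because \<open>mass_distribution_cover\<close> demands a strict bound on
    the diameter.\<close>
  define \<delta> where "\<delta> = g * exp (- (real M * lmax)) / 2"
  have \<delta>: "0 < \<delta>" "\<delta> < g * exp (- (real M * lmax))" using g_pos by (auto simp: \<delta>_def)
  have "ennreal (g powr s) * emeasure (bernoulli t) (G M) \<le> hausdorff_content \<delta> s (level_set \<alpha>)"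
    unfolding hausdorff_content_def
  proof (rule INF_greatest)
    fix U :: "nat \<Rightarrow> real set"
    assume "U \<in> {U. level_set \<alpha> \<subseteq> \<Union> (range U) \<and> (\<forall>i. bounded (U i) \<and> diameter (U i) \<le> \<delta>)}"
    then have cover: "level_set \<alpha> \<subseteq> (\<Union>i. U i)" and U: "bounded (U i)" "diameter (U i) \<le> \<delta>" for i
      by auto
    define covers where "covers i W \<longleftrightarrow> W \<in> sets (bernoulli t) \<and> {\<omega> \<in> G M. code \<omega> \<in> U i} \<subseteq> W \<and>
        emeasure (bernoulli t) W \<le> ennreal ((diameter (U i) / g) powr s)" for i W
    have "\<exists>W\<in>sets (bernoulli t). {\<omega> \<in> G M. code \<omega> \<in> U i} \<subseteq> W \<and>
           emeasure (bernoulli t) W \<le> ennreal ((diameter (U i) / g) powr s)" for i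
    proof (rule mass_distribution_cover[OF s U(1)])
      show "diameter (U i) < g * exp (- (real M * lmax))" using U(2)[of i] \<delta>(2) by simp
    qed (auto simp: G_def)
    then have "\<forall>i. \<exists>W. covers i W" unfolding covers_def by blast
    then obtain W where "\<And>i. covers i (W i)" by metis
    then have W: "W i \<in> sets (bernoulli t)" "{\<omega> \<in> G M. code \<omega> \<in> U i} \<subseteq> W i"
        "emeasure (bernoulli t) (W i) \<le> ennreal ((diameter (U i) / g) powr s)" for i
      unfolding covers_def by blast+
    have "AE \<omega> in bernoulli t. \<omega> \<in> G M \<longrightarrow> \<omega> \<in> (\<Union>i. W i)"
      using conv AE_space
    proof eventually_elim
      case (elim \<omega>)
      then have \<omega>: "\<omega> k \<in> {1..n}" for k by (auto simp: space_bernoulli)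
      have "code \<omega> \<in> level_set \<alpha>"
        using elim code_in_repeller[of \<omega>, OF \<omega>] itin_code[of \<omega>, OF \<omega>]
        by (simp add: level_set_def has_lyapunov_exponent_iff)
      then show ?case using cover W(2) by blast
    qed
    then have "emeasure (bernoulli t) (G M) \<le> emeasure (bernoulli t) (\<Union>i. W i)"
      using W(1) by (intro emeasure_mono_AE) auto
    also have "\<dots> \<le> (\<Sum>i. emeasure (bernoulli t) (W i))"
      using W(1) by (intro emeasure_subadditive_countably) auto
    also have "\<dots> \<le> (\<Sum>i. ennreal ((diameter (U i) / g) powr s))"
      using W(3) by (intro suminf_le) auto
    finally have "ennreal (g powr s) * emeasure (bernoulli t) (G M)
        \<le> ennreal (g powr s) * (\<Sum>i. ennreal ((diameter (U i) / g) powr s))"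
      by (rule mult_left_mono) simp
    also have "\<dots> = (\<Sum>i. ennreal (g powr s) * ennreal ((diameter (U i) / g) powr s))"
      by simp
    also have "\<dots> = (\<Sum>i. ennreal (diameter (U i) powr s))"
    proof (intro suminf_cong)
      fix i
      have "g powr s * (diameter (U i) / g) powr s = diameter (U i) powr s"
        using g_pos diameter_ge_0[OF U(1)[of i]] by (simp add: powr_divide)
      then show "ennreal (g powr s) * ennreal ((diameter (U i) / g) powr s) = ennreal (diameter (U i) powr s)"
        by (simp flip: ennreal_mult)
    qed
    finally show "ennreal (g powr s) * emeasure (bernoulli t) (G M) \<le> (\<Sum>i. ennreal (diameter (U i) powr s))" .
  qed
  moreover have "0 < ennreal (g powr s) * emeasure (bernoulli t) (G M)"
    using M g_pos by (simp add: ennreal_zero_less_mult_iff)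
  moreover have "hausdorff_content \<delta> s (level_set \<alpha>) \<le> hausdorff_measure s (level_set \<alpha>)"
    unfolding hausdorff_measure_def using \<delta> by (intro SUP_upper) auto
  ultimately show ?thesis by simp
qed

section \<open>The spectrum in terms of the pressure\<close>

lemma pressure_has_derivative:
  "(pressure has_real_derivative (\<Sum>i=1..n. l i * exp (t * l i)) / (\<Sum>i=1..n. exp (t * l i))) (at t)"
proof -
  have "0 < (\<Sum>i=1..n. exp (t * l i))" using n_pos by (intro sum_pos) auto
  then show ?thesis unfolding pressure_def[abs_def]
    by (auto intro!: derivative_eq_intros simp: mult.commute)
qed

text \<open>\<open>\<alpha>\<close> is a weighted mean of the \<open>l i\<close>, and each
  \<open>t * l i\<close> is at most the pressure, since one summand is at most the whole sum. This
  makes the candidate dimension nonnegative, so that it survives \<open>ennreal\<close> and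
  \<open>enn2real\<close>.\<close>

lemma tangent_le_pressure:
  assumes "(pressure has_real_derivative \<alpha>) (at t)"
  shows "t * \<alpha> \<le> pressure t"
proof -
  define Z where "Z = (\<Sum>i=1..n. exp (t * l i))"
  have Z: "0 < Z" unfolding Z_def using n_pos by (intro sum_pos) auto
  have le: "t * l i \<le> pressure t" if "i \<in> {1..n}" for i
  proof -
    have "exp (t * l i) \<le> exp (pressure t)"
      unfolding exp_pressure using that by (intro member_le_sum) auto
    then show ?thesis by simp
  qed
  have "\<alpha> = (\<Sum>i=1..n. l i * exp (t * l i)) / Z"
    unfolding Z_def by (rule DERIV_unique[OF assms pressure_has_derivative])
  then have "t * \<alpha> * Z = (\<Sum>i=1..n. (t * l i) * exp (t * l i))"
    using Z by (simp add: sum_distrib_left mult.assoc)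
  also have "\<dots> \<le> (\<Sum>i=1..n. pressure t * exp (t * l i))"
    by (intro sum_mono mult_right_mono le) auto
  also have "\<dots> = pressure t * Z" by (simp add: Z_def sum_distrib_left)
  finally show ?thesis using Z by simp
qed

text \<open>The value \<open>pressure t / \<alpha> - t\<close> is the exponent \<open>s\<close> at
  which \<open>(s + t) * \<alpha>\<close> passes \<open>pressure t\<close>: above it the measure
  vanishes, and at positive exponents below it the measure is positive.\<close>

lemma lyapunov_spectrum_eq:
  assumes D: "(pressure has_real_derivative \<alpha>) (at t)" and \<alpha>: "0 < \<alpha>"
  shows "lyapunov_spectrum n X f \<alpha> = pressure t / \<alpha> - t"
proof -
  define d where "d = pressure t / \<alpha> - t"
  have d: "0 \<le> d" using tangent_le_pressure[OF D] \<alpha> by (simp add: d_def field_simps)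
  have "hausdorff_dim (level_set \<alpha>) = ennreal d"
    unfolding hausdorff_dim_def
  proof (rule antisym)
    show "Inf {ennreal s |s. 0 < s \<and> hausdorff_measure s (level_set \<alpha>) = 0} \<le> ennreal d"
    proof (rule ennreal_le_epsilon)
      fix e :: real assume "0 < e"
      have "(d + e + t) * \<alpha> = pressure t + e * \<alpha>" using \<alpha> by (simp add: d_def field_simps)
      then have "pressure t < (d + e + t) * \<alpha>" using \<open>0 < e\<close> \<alpha> by simp
      then have "hausdorff_measure (d + e) (level_set \<alpha>) = 0"
        using d \<open>0 < e\<close> by (intro hausdorff_measure_level_set_eq_0[where t = t]) auto
      then have "Inf {ennreal s |s. 0 < s \<and> hausdorff_measure s (level_set \<alpha>) = 0} \<le> ennreal (d + e)"
        using d \<open>0 < e\<close> by (intro Inf_lower CollectI exI[of _ "d + e"]) auto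
      then show "Inf {ennreal s |s. 0 < s \<and> hausdorff_measure s (level_set \<alpha>) = 0} \<le> ennreal d + ennreal e"
        using d \<open>0 < e\<close> by (simp add: ennreal_plus)
    qed
    show "ennreal d \<le> Inf {ennreal s |s. 0 < s \<and> hausdorff_measure s (level_set \<alpha>) = 0}"
    proof (rule Inf_greatest)
      fix x assume "x \<in> {ennreal s |s. 0 < s \<and> hausdorff_measure s (level_set \<alpha>) = 0}"
      then obtain s where x: "x = ennreal s" and s: "0 < s" "hausdorff_measure s (level_set \<alpha>) = 0"
        by blast
      have "\<not> (s + t) * \<alpha> < pressure t"
        using hausdorff_measure_level_set_pos[OF D s(1)] s(2) by auto
      then show "ennreal d \<le> x"
        unfolding x using \<alpha> by (intro ennreal_leI) (simp add: d_def field_simps)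
    qed
  qed
  then show ?thesis using d by (simp add: lyapunov_spectrum_def level_set_def d_def)
qed

end

subsection \<open>Inflections and zeros\<close>

text \<open>Rolle's theorem in counting form. Mapping each zero of \<open>h\<close> to the next zero
  of \<open>h'\<close> above it is injective on all but the largest zero of a finite set.\<close>

lemma zeros_le_Suc_zeros_deriv:
  fixes h :: "real \<Rightarrow> real"
  assumes h: "\<And>x. (h has_real_derivative h' x) (at x)" and fin: "finite {x. h' x = 0}"
  shows "finite {x. h x = 0} \<and> card {x. h x = 0} \<le> Suc (card {x. h' x = 0})"
proof -
  let ?Z = "{x. h' x = 0}"
  have rolle: "\<exists>c\<in>?Z. x < c \<and> c < y" if "x < y" "h x = 0" "h y = 0" for x y
  proof -
    have "\<exists>c. x < c \<and> c < y \<and> (h has_real_derivative 0) (at c)"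
    proof (rule Rolle)
      show "continuous_on {x..y} h"
        by (intro continuous_at_imp_continuous_on ballI DERIV_isCont[OF h])
      show "h differentiable (at c)" for c using h[of c] by (auto simp: real_differentiable_def)
    qed (use that in auto)
    then obtain c where c: "x < c" "c < y" "(h has_real_derivative 0) (at c)" by blast
    then show ?thesis using DERIV_unique[OF h c(3)] by auto
  qed
  have bound: "card A \<le> Suc (card ?Z)" if A: "finite A" "A \<subseteq> {x. h x = 0}" for A
  proof (cases "A = {}")
    case False
    define c where "c x = Min {z \<in> ?Z. x < z}" for x
    have c: "c x \<in> ?Z" "x < c x" "c x < y" if xy: "x \<in> A" "y \<in> A" "x < y" for x y
    proof -
      obtain z where z: "z \<in> ?Z" "x < z" "z < y" using rolle[of x y] xy A(2) by blast
      have "c x \<in> {z \<in> ?Z. x < z}" unfolding c_def using z fin by (intro Min_in) auto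
      then show "c x \<in> ?Z" "x < c x" by auto
      have "c x \<le> z" unfolding c_def using z fin by (intro Min_le) auto
      then show "c x < y" using z by simp
    qed
    have Max: "x < Max A" "Max A \<in> A" if "x \<in> A - {Max A}" for x
      using that Max_ge[OF A(1), of x] less_le[of x "Max A"] Max_in[OF A(1) False] by blast+
    have "inj_on c (A - {Max A})"
    proof (rule linorder_inj_onI)
      fix x y assume "x < y" "x \<in> A - {Max A}" "y \<in> A - {Max A}"
      then have "c x < y" "y < c y" using c(3)[of x y] c(2)[of y "Max A"] Max[of y] by auto
      then show "c x \<noteq> c y" by simp
    qed auto
    moreover have "c ` (A - {Max A}) \<subseteq> ?Z" using c(1) Max by blast
    ultimately have "card (A - {Max A}) \<le> card ?Z" using fin by (rule card_inj_on_le)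
    then show ?thesis using A False Max_in[OF A(1) False] by simp
  qed simp
  \<comment> \<open>An infinite zero set would contain a finite set with one element more than
    \<open>bound\<close> permits.\<close>
  have "finite {x. h x = 0}"
  proof (rule ccontr)
    assume "infinite {x. h x = 0}"
    then obtain A where "finite A" "card A = Suc (Suc (card ?Z))" "A \<subseteq> {x. h x = 0}"
      using infinite_arbitrarily_large by blast
    then show False using bound[of A] by simp
  qed
  then show ?thesis using bound by blast
qed

text \<open>In the variable \<open>\<beta> = P1 t\<close> the first derivative of \<open>L\<close> is \<open>- P t / \<beta>\<^sup>2\<close>.\<close>

lemma inflections_legendre:
  fixes P P1 P2 L :: "real \<Rightarrow> real"
  assumes P: "\<And>t. (P has_real_derivative P1 t) (at t)"
    and P1: "\<And>t. (P1 has_real_derivative P2 t) (at t)"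
    and P2: "\<And>t. 0 < P2 t"
    and range_P1: "range P1 = {A<..<B}" and A: "0 \<le> A"
    and L: "\<And>t. L (P1 t) = P t / P1 t - t"
  shows "{\<alpha>. \<alpha> \<in> {A<..<B} \<and> (\<forall>\<^sub>F \<beta> in nhds \<alpha>. L differentiable (at \<beta>)) \<and>
            (deriv L has_real_derivative 0) (at \<alpha>)} = P1 ` {t. 2 * P t * P2 t = (P1 t)\<^sup>2}"
    and "inj P1"
proof -
  have mono: "P1 x < P1 y" if "x < y" for x y
    by (rule DERIV_pos_imp_increasing[OF that]) (use P1 P2 in blast)
  show inj: "inj P1" by (rule linorder_injI) (auto dest: mono)
  \<comment> \<open>\<open>inv\<close> is arbitrary off the range of \<open>P1\<close>, so the
    identities that start from a given \<open>\<beta>\<close> are confined to the open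
    interval.\<close>
  define \<tau> where "\<tau> = inv P1"
  have \<tau>_P1: "\<tau> (P1 t) = t" for t using inj by (simp add: \<tau>_def)
  have P1_\<tau>: "P1 (\<tau> \<beta>) = \<beta>" if "\<beta> \<in> {A<..<B}" for \<beta>
    using that range_P1 by (simp add: \<tau>_def f_inv_into_f)
  have D\<tau>: "(\<tau> has_real_derivative inverse (P2 (\<tau> \<beta>))) (at \<beta>)" if \<beta>: "\<beta> \<in> {A<..<B}" for \<beta>
  proof (rule DERIV_inverse_function)
    show "isCont \<tau> \<beta>"
    proof -
      have "isCont \<tau> (P1 (\<tau> \<beta>))"
        by (rule isCont_inverse_function[of 1]) (simp_all add: \<tau>_P1 DERIV_isCont[OF P1])
      then show ?thesis by (simp add: P1_\<tau>[OF \<beta>])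
    qed
    show "A < \<beta>" "\<beta> < B" using \<beta> by auto
    show "P2 (\<tau> \<beta>) \<noteq> 0" using P2[of "\<tau> \<beta>"] by simp
  qed (use P1 P1_\<tau> in auto)
  have pos: "0 < \<beta>" if "\<beta> \<in> {A<..<B}" for \<beta> using that A by simp
  have L_eq: "L \<beta> = P (\<tau> \<beta>) / \<beta> - \<tau> \<beta>" if "\<beta> \<in> {A<..<B}" for \<beta>
    using L[of "\<tau> \<beta>"] P1_\<tau>[OF that] by simp
  have DP\<tau>: "((\<lambda>\<beta>. P (\<tau> \<beta>)) has_real_derivative \<beta> * inverse (P2 (\<tau> \<beta>))) (at \<beta>)"
    if "\<beta> \<in> {A<..<B}" for \<beta>
    using DERIV_chain2[OF P D\<tau>[OF that]] P1_\<tau>[OF that] by simp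
  have DL: "(L has_real_derivative - P (\<tau> \<beta>) / \<beta>\<^sup>2) (at \<beta>)" if \<beta>: "\<beta> \<in> {A<..<B}" for \<beta>
  proof -
    \<comment> \<open>Since \<open>P1 (\<tau> \<beta>) = \<beta>\<close>, the derivative of
      \<open>P (\<tau> \<beta>)\<close> divided by \<open>\<beta>\<close> cancels the derivative of
      \<open>\<tau>\<close>.\<close>
    have "((\<lambda>\<beta>. P (\<tau> \<beta>) / \<beta> - \<tau> \<beta>) has_real_derivative - P (\<tau> \<beta>) / \<beta>\<^sup>2) (at \<beta>)"
      using pos[OF \<beta>] P2[of "\<tau> \<beta>"]
      by (intro DERIV_diff[OF DERIV_divide[OF DP\<tau>[OF \<beta>] DERIV_ident] D\<tau>[OF \<beta>], THEN DERIV_cong])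
         (auto simp: field_simps power2_eq_square)
    then show ?thesis
      by (rule has_field_derivative_transform_within_open[of _ _ _ "{A<..<B}"]) (use \<beta> L_eq in auto)
  qed
  have DL2: "(deriv L has_real_derivative (2 * P (\<tau> \<beta>) * P2 (\<tau> \<beta>) - \<beta>\<^sup>2) / (\<beta> ^ 3 * P2 (\<tau> \<beta>))) (at \<beta>)"
    if \<beta>: "\<beta> \<in> {A<..<B}" for \<beta>
  proof -
    have "((\<lambda>\<beta>. - P (\<tau> \<beta>) / \<beta>\<^sup>2) has_real_derivative
        (2 * P (\<tau> \<beta>) * P2 (\<tau> \<beta>) - \<beta>\<^sup>2) / (\<beta> ^ 3 * P2 (\<tau> \<beta>))) (at \<beta>)"
      using pos[OF \<beta>] P2[of "\<tau> \<beta>"]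
      by (intro DERIV_divide[OF DERIV_minus[OF DP\<tau>[OF \<beta>]] DERIV_power[OF DERIV_ident, where n = 2], THEN DERIV_cong])
         (auto simp: field_simps power2_eq_square power3_eq_cube)
    then show ?thesis
      by (rule has_field_derivative_transform_within_open[of _ _ _ "{A<..<B}"])
         (use \<beta> DERIV_imp_deriv[OF DL] in auto)
  qed
  have diff: "\<forall>\<^sub>F \<beta> in nhds \<alpha>. L differentiable (at \<beta>)" if "\<alpha> \<in> {A<..<B}" for \<alpha>
  proof -
    have "\<forall>\<^sub>F \<beta> in nhds \<alpha>. \<beta> \<in> {A<..<B}" using that by (intro eventually_nhds_in_open) auto
    then show ?thesis unfolding real_differentiable_def by eventually_elim (rule exI, rule DL)
  qed
  have iff: "(deriv L has_real_derivative 0) (at (P1 t)) \<longleftrightarrow> 2 * P t * P2 t = (P1 t)\<^sup>2" for t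
  proof -
    have \<beta>: "P1 t \<in> {A<..<B}" using range_P1 by blast
    have "(deriv L has_real_derivative 0) (at (P1 t)) \<longleftrightarrow> (2 * P t * P2 t - (P1 t)\<^sup>2) / (P1 t ^ 3 * P2 t) = 0"
      using DL2[OF \<beta>] DERIV_unique[OF DL2[OF \<beta>], of 0] by (auto simp: \<tau>_P1)
    then show ?thesis using pos[OF \<beta>] P2[of t] by simp
  qed
  show "{\<alpha>. \<alpha> \<in> {A<..<B} \<and> (\<forall>\<^sub>F \<beta> in nhds \<alpha>. L differentiable (at \<beta>)) \<and>
            (deriv L has_real_derivative 0) (at \<alpha>)} = P1 ` {t. 2 * P t * P2 t = (P1 t)\<^sup>2}"
    unfolding range_P1[symmetric] using iff diff[folded range_P1] by (auto simp: image_iff)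
qed

subsection \<open>The four-branch example\<close>

text \<open>
  With \<open>z = exp (60 * t)\<close>, \<open>gen k\<close> is the result of applying \<open>z d/dz\<close> to \<open>1 + 2 * z + z ^ 200\<close> \<open>k\<close> times;
  the pressure of the example is \<open>3 * t + ln (gen 0 t)\<close>.
\<close>

definition gen :: "nat \<Rightarrow> real \<Rightarrow> real" where
  "gen k t = 0 ^ k + 2 * exp (60 * t) + 200 ^ k * exp (60 * t) ^ 200"

lemma gen_has_derivative: "(gen k has_real_derivative 60 * gen (Suc k) t) (at t)"
proof -
  have "exp (60 * t) ^ 200 = exp (60 * t) * exp (60 * t) ^ 199"
    by (simp flip: power_Suc)
  then show ?thesis unfolding gen_def[abs_def]
    by (auto intro!: derivative_eq_intros simp: algebra_simps)
qed

lemma gen_0_pos: "0 < gen 0 t"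
  by (auto simp: gen_def intro!: add_pos_pos)

lemma gen_1_nonneg: "0 \<le> gen 1 t"
  by (auto simp: gen_def intro!: add_nonneg_nonneg)

section \<open>The pressure of the example and its derivatives\<close>

definition prs :: "real \<Rightarrow> real" where "prs t = 3 * t + ln (gen 0 t)"

definition prs1 :: "real \<Rightarrow> real" where "prs1 t = 3 + 60 * (gen 1 t / gen 0 t)"

text \<open>\<open>gen k t / gen 0 t\<close> is the \<open>k\<close>-th moment of the values 0, 1,
  200 under weights proportional to 1, \<open>2 * z\<close>, \<open>z ^ 200\<close>. Thus
  \<open>var_num\<close> is the variance cleared of its denominator. The chain rule for
  \<open>z\<close> contributes a factor 60 for each derivative, hence 3600 in
  \<open>prs2\<close>.\<close>

definition var_num :: "real \<Rightarrow> real" where "var_num t = gen 2 t * gen 0 t - (gen 1 t)\<^sup>2"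

definition prs2 :: "real \<Rightarrow> real" where "prs2 t = 3600 * (var_num t / (gen 0 t)\<^sup>2)"

text \<open>The third cumulant of the same distribution, cleared of its denominator.\<close>

definition skew_num :: "real \<Rightarrow> real" where
  "skew_num t = gen 3 t * (gen 0 t)\<^sup>2 - 3 * gen 0 t * gen 1 t * gen 2 t + 2 * gen 1 t ^ 3"

definition prs3 :: "real \<Rightarrow> real" where "prs3 t = 216000 * (skew_num t / gen 0 t ^ 3)"

lemma prs_has_derivative: "(prs has_real_derivative prs1 t) (at t)"
  unfolding prs_def[abs_def] prs1_def
  using gen_0_pos[of t] by (auto intro!: derivative_eq_intros gen_has_derivative)

lemma prs1_has_derivative: "(prs1 has_real_derivative prs2 t) (at t)"
  unfolding prs1_def[abs_def] prs2_def var_num_def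
  using gen_0_pos[of t]
  by (auto intro!: derivative_eq_intros gen_has_derivative simp: field_simps power2_eq_square numeral_2_eq_2)

lemma prs2_has_derivative: "(prs2 has_real_derivative prs3 t) (at t)"
proof -
  have "((\<lambda>t. 3600 * (var_num t / (gen 0 t)\<^sup>2)) has_real_derivative
     3600 * (((60 * gen 3 t * gen 0 t + gen 2 t * (60 * gen 1 t) - 2 * gen 1 t * (60 * gen 2 t)) * (gen 0 t)\<^sup>2
       - var_num t * (2 * gen 0 t * (60 * gen 1 t))) / ((gen 0 t)\<^sup>2 * (gen 0 t)\<^sup>2))) (at t)"
    unfolding var_num_def using gen_0_pos[of t]
    by (auto intro!: derivative_eq_intros gen_has_derivative simp: numeral_3_eq_3 numeral_2_eq_2 algebra_simps)
  moreover have "3600 * (((60 * gen 3 t * gen 0 t + gen 2 t * (60 * gen 1 t) - 2 * gen 1 t * (60 * gen 2 t)) * (gen 0 t)\<^sup>2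
       - var_num t * (2 * gen 0 t * (60 * gen 1 t))) / ((gen 0 t)\<^sup>2 * (gen 0 t)\<^sup>2)) = prs3 t"
  proof -
    have "(60 * gen 3 t * gen 0 t + gen 2 t * (60 * gen 1 t) - 2 * gen 1 t * (60 * gen 2 t)) * (gen 0 t)\<^sup>2
       - var_num t * (2 * gen 0 t * (60 * gen 1 t)) = 60 * (gen 0 t * skew_num t)"
      unfolding skew_num_def var_num_def by (simp add: algebra_simps power2_eq_square power3_eq_cube)
    then show ?thesis
      unfolding prs3_def using gen_0_pos[of t] by (simp add: power2_eq_square power3_eq_cube)
  qed
  ultimately show ?thesis unfolding prs2_def[abs_def] by simp
qed

text \<open>The variance as a sum over pairs of values of the product of weights times the squared
  difference, with differences 1, 200 and 199. Positivity is then visible.\<close>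

lemma var_num_eq:
  assumes "z = exp (60 * t)"
  shows "var_num t = 2 * z + 40000 * z ^ 200 + 79202 * z * z ^ 200"
  unfolding var_num_def gen_def assms[symmetric]
  by (simp add: algebra_simps power2_eq_square)

lemma skew_num_eq:
  assumes "z = exp (60 * t)"
  shows "skew_num t = z * (2 - 4 * z + 8000000 * z ^ 199 + 31758804 * z ^ 200 + 31522396 * z ^ 201
           - 8000000 * z ^ 399 - 15761198 * z ^ 400)"
proof -
  \<comment> \<open>\<open>y\<close> stands for \<open>z ^ 200\<close>, so that the expansion
    involves only small powers.\<close>
  have *: "(0 ^ 3 + 2 * z + 200 ^ 3 * y) * (0 ^ 0 + 2 * z + 200 ^ 0 * y)\<^sup>2
      - 3 * (0 ^ 0 + 2 * z + 200 ^ 0 * y) * (0 ^ 1 + 2 * z + 200 ^ 1 * y) * (0 ^ 2 + 2 * z + 200 ^ 2 * y)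
      + 2 * (0 ^ 1 + 2 * z + 200 ^ 1 * y) ^ 3
    = 2 * z - 4 * z * z + 8000000 * y + 31758804 * (z * y) + 31522396 * (z * (z * y))
      - 8000000 * (y * y) - 15761198 * (z * (y * y))" for y :: real
    by (simp add: algebra_simps power2_eq_square power3_eq_cube)
  have "z * z ^ 199 = z ^ 200" "z * z ^ 200 = z ^ 201" "z * z ^ 399 = z ^ 200 * z ^ 200"
    "z * z ^ 400 = z * (z ^ 200 * z ^ 200)"
    by (simp_all flip: power_Suc power_add)
  then show ?thesis
    unfolding skew_num_def gen_def assms[symmetric] *
    by (simp add: algebra_simps)
qed

section \<open>Counting the zeros of the third derivative\<close>

lemma exp60_power_has_derivative:
  "((\<lambda>t. exp (60 * t) ^ k) has_real_derivative 60 * (real k * exp (60 * t) ^ k)) (at t)"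
proof -
  have "((\<lambda>t. exp (real k * (60 * t))) has_real_derivative exp (real k * (60 * t)) * (real k * 60)) (at t)"
    by (auto intro!: derivative_eq_intros)
  then show ?thesis unfolding exp_of_nat_mult by (simp add: mult_ac)
qed

text \<open>
  After the two Rolle steps the remaining factor has coefficients with a single change of sign, so
  the two groups of terms balance at one point at most.
\<close>

lemma one_sign_change:
  fixes a b c d e x y :: real
  assumes "0 < a" "0 \<le> b" "0 \<le> c" "0 \<le> d" "0 \<le> e" and "0 < x" "x < y"
    and x: "a + b * x + c * x\<^sup>2 = (d + e * x) * x ^ 200"
  shows "a + b * y + c * y\<^sup>2 \<noteq> (d + e * y) * y ^ 200"
proof -
  \<comment> \<open>Passing from \<open>x\<close> to \<open>y\<close> multiplies the left side by
    less than \<open>r\<^sup>2\<close> but the right side by at least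
    \<open>r ^ 200\<close>.\<close>
  define r where "r = y / x"
  have r: "1 < r" and y: "y = r * x" using assms by (auto simp: r_def)
  have r2: "1 < r\<^sup>2" using r by simp
  have "a + b * y + c * y\<^sup>2 < r\<^sup>2 * a + r\<^sup>2 * (b * x) + r\<^sup>2 * (c * x\<^sup>2)"
  proof -
    have "a < r\<^sup>2 * a" using r2 assms by simp
    moreover have "b * y \<le> r\<^sup>2 * (b * x)"
      unfolding y using r assms mult_right_mono[of r "r\<^sup>2" "b * x"] by (simp add: power2_eq_square mult_ac)
    ultimately show ?thesis by (simp add: y power_mult_distrib mult_ac)
  qed
  also have "\<dots> = r\<^sup>2 * ((d + e * x) * x ^ 200)" unfolding x[symmetric] by (simp add: algebra_simps)
  also have "\<dots> \<le> r ^ 200 * ((d + e * x) * x ^ 200)"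
    using r assms by (intro mult_right_mono power_increasing) auto
  also have "\<dots> \<le> (d + e * y) * y ^ 200"
  proof -
    have "(d + e * x) * y ^ 200 \<le> (d + e * y) * y ^ 200"
      using assms by (intro mult_right_mono add_left_mono mult_left_mono) auto
    then show ?thesis by (simp add: y power_mult_distrib mult_ac)
  qed
  finally show ?thesis by simp
qed

text \<open>Descartes' rule of signs for this polynomial. Each differentiation removes the lowest
  term and with it one sign change, at the price of one zero; exponential factors are divided out in
  between. The final \<open>q2\<close> has at most one zero.\<close>

lemma card_zeros_skew_num: "finite {t. skew_num t = 0} \<and> card {t. skew_num t = 0} \<le> 3"
proof -
  \<comment> \<open>The quotient of \<open>skew_num\<close> by \<open>z\<close>. The exponent 1 is
    written out so that one derivative rule fits every term.\<close>
  define q0 where "q0 t = 2 - 4 * exp (60 * t) ^ 1 + 8000000 * exp (60 * t) ^ 199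
    + 31758804 * exp (60 * t) ^ 200 + 31522396 * exp (60 * t) ^ 201
    - 8000000 * exp (60 * t) ^ 399 - 15761198 * exp (60 * t) ^ 400" for t :: real
  define q1 where "q1 t = - 4 + 199 * 8000000 * exp (60 * t) ^ 198
    + 200 * 31758804 * exp (60 * t) ^ 199 + 201 * 31522396 * exp (60 * t) ^ 200
    - 399 * 8000000 * exp (60 * t) ^ 398 - 400 * 15761198 * exp (60 * t) ^ 399" for t :: real
  \<comment> \<open>\<open>u - v\<close> is the derivative of \<open>q1\<close> with the factor
    \<open>60 * z ^ 198\<close> removed, split by the sign of the coefficients.\<close>
  define u where "u x = 198 * 199 * 8000000 + 199 * 200 * 31758804 * x + 200 * 201 * 31522396 * x\<^sup>2" for x :: real
  define v where "v x = (398 * 399 * 8000000 + 399 * 400 * 15761198 * x) * x ^ 200" for x :: real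
  define q2 where "q2 t = u (exp (60 * t)) - v (exp (60 * t))" for t
  have D0: "(q0 has_real_derivative 60 * exp (60 * t) * q1 t) (at t)" for t
  proof -
    define z where "z = exp (60 * t)"
    have z: "z * z ^ 198 = z ^ 199" "z * z ^ 199 = z ^ 200" "z * z ^ 200 = z ^ 201"
        "z * z ^ 398 = z ^ 399" "z * z ^ 399 = z ^ 400"
      by (simp_all flip: power_Suc)
    have "(q0 has_real_derivative 60 * (- 4 * z + 199 * 8000000 * z ^ 199 + 200 * 31758804 * z ^ 200
      + 201 * 31522396 * z ^ 201 - 399 * 8000000 * z ^ 399 - 400 * 15761198 * z ^ 400)) (at t)"
      unfolding q0_def[abs_def] z_def
      by (rule DERIV_cong, (rule DERIV_add DERIV_diff DERIV_const DERIV_cmult exp60_power_has_derivative)+) simp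
    moreover have "60 * (- 4 * z + 199 * 8000000 * z ^ 199 + 200 * 31758804 * z ^ 200
      + 201 * 31522396 * z ^ 201 - 399 * 8000000 * z ^ 399 - 400 * 15761198 * z ^ 400) = 60 * z * q1 t"
      unfolding q1_def z_def[symmetric] z[symmetric] by (simp add: algebra_simps)
    ultimately show ?thesis by (simp add: z_def)
  qed
  have D1: "(q1 has_real_derivative 60 * exp (60 * t) ^ 198 * q2 t) (at t)" for t
  proof -
    define z where "z = exp (60 * t)"
    have z: "z ^ 199 = z ^ 198 * z" "z ^ 200 = z ^ 198 * z\<^sup>2"
        "z ^ 398 = z ^ 198 * z ^ 200" "z ^ 399 = z ^ 198 * (z * z ^ 200)"
      by (simp_all flip: power_Suc power_Suc2 power_add)
    have dq1: "(q1 has_real_derivative 60 * (198 * 199 * 8000000 * z ^ 198 + 199 * 200 * 31758804 * z ^ 199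
      + 200 * 201 * 31522396 * z ^ 200 - 398 * 399 * 8000000 * z ^ 398 - 399 * 400 * 15761198 * z ^ 399)) (at t)"
      unfolding q1_def[abs_def] z_def
      by (rule DERIV_cong, (rule DERIV_add DERIV_diff DERIV_const DERIV_cmult exp60_power_has_derivative)+) simp
    have eq: "198 * 199 * 8000000 * z ^ 198 + 199 * 200 * 31758804 * z ^ 199
      + 200 * 201 * 31522396 * z ^ 200 - 398 * 399 * 8000000 * z ^ 398 - 399 * 400 * 15761198 * z ^ 399
      = z ^ 198 * q2 t"
    proof -
      have "z ^ 198 * q2 t = 198 * 199 * 8000000 * z ^ 198 + 199 * 200 * 31758804 * (z ^ 198 * z)
        + 200 * 201 * 31522396 * (z ^ 198 * z\<^sup>2) - 398 * 399 * 8000000 * (z ^ 198 * z ^ 200)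
        - 399 * 400 * 15761198 * (z ^ 198 * (z * z ^ 200))"
        unfolding q2_def u_def v_def z_def[symmetric] by (simp add: algebra_simps)
      then show ?thesis unfolding z(1)[symmetric] z(2)[symmetric] z(3)[symmetric] z(4)[symmetric] by simp
    qed
    show ?thesis using dq1 unfolding eq by (simp only: z_def mult.assoc)
  qed
  have unique: "s = t" if "q2 s = 0" "q2 t = 0" for s t
  proof -
    have no: "u y \<noteq> v y" if "u x = v x" "0 < x" "x < y" for x y
      using that unfolding u_def v_def by (intro one_sign_change[of _ _ _ _ _ x y]) auto
    have "exp (60 * s) = exp (60 * t)"
      using that no[of "exp (60 * s)" "exp (60 * t)"] no[of "exp (60 * t)" "exp (60 * s)"]
      by (cases "exp (60 * s)" "exp (60 * t)" rule: linorder_cases) (auto simp: q2_def)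
    then show ?thesis by simp
  qed
  have q2: "finite {t. q2 t = 0} \<and> card {t. q2 t = 0} \<le> 1"
  proof (cases "\<exists>t. q2 t = 0")
    case True
    then obtain t where "q2 t = 0" ..
    then have "{t. q2 t = 0} = {t}" using unique by auto
    then show ?thesis by simp
  qed simp
  have "{t. 60 * exp (60 * t) ^ 198 * q2 t = 0} = {t. q2 t = 0}" by simp
  then have q1: "finite {t. q1 t = 0} \<and> card {t. q1 t = 0} \<le> 2"
    using zeros_le_Suc_zeros_deriv[of q1 "\<lambda>t. 60 * exp (60 * t) ^ 198 * q2 t", OF D1] q2 by auto
  have "{t. 60 * exp (60 * t) * q1 t = 0} = {t. q1 t = 0}" by simp
  then have q0: "finite {t. q0 t = 0} \<and> card {t. q0 t = 0} \<le> 3"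
    using zeros_le_Suc_zeros_deriv[of q0 "\<lambda>t. 60 * exp (60 * t) * q1 t", OF D0] q1 by auto
  have "skew_num t = exp (60 * t) * q0 t" for t
    unfolding skew_num_eq[OF refl] q0_def by simp
  then have "{t. skew_num t = 0} = {t. q0 t = 0}" by simp
  then show ?thesis using q0 by simp
qed

lemma prs2_pos: "0 < prs2 t"
proof -
  have "0 < var_num t" unfolding var_num_eq[OF refl] by (intro add_pos_pos) auto
  then show ?thesis using gen_0_pos[of t] by (simp add: prs2_def)
qed

lemma prs1_ge: "3 \<le> prs1 t"
  using gen_0_pos[of t] gen_1_nonneg[of t] by (simp add: prs1_def)

section \<open>The function whose zeros give the inflections\<close>

text \<open>The function \<open>H\<close> of the overview. Dividing by \<open>prs2\<close>, rather
  than using the polynomial form of the inflection condition, is what makes its derivative a single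
  product.\<close>

definition defect :: "real \<Rightarrow> real" where "defect t = prs t - (prs1 t)\<^sup>2 / (2 * prs2 t)"

lemma defect_sign:
  "defect t < 0 \<longleftrightarrow> 2 * prs t * prs2 t < (prs1 t)\<^sup>2" "0 < defect t \<longleftrightarrow> (prs1 t)\<^sup>2 < 2 * prs t * prs2 t"
  "defect t = 0 \<longleftrightarrow> 2 * prs t * prs2 t = (prs1 t)\<^sup>2"
  using prs2_pos[of t] by (auto simp: defect_def field_simps)

text \<open>Differentiating the square produces exactly \<open>prs1\<close>, which cancels the
  derivative of \<open>prs\<close>; only the term with \<open>prs3\<close> remains.\<close>

lemma defect_has_derivative:
  "(defect has_real_derivative (prs1 t)\<^sup>2 * prs3 t / (2 * (prs2 t)\<^sup>2)) (at t)"
  unfolding defect_def[abs_def] using prs2_pos[of t]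
  by (auto intro!: derivative_eq_intros prs_has_derivative prs1_has_derivative prs2_has_derivative
      simp: field_simps power2_eq_square)

lemma card_zeros_defect_le: "finite {t. defect t = 0} \<and> card {t. defect t = 0} \<le> 4"
proof -
  have "(prs1 t)\<^sup>2 * prs3 t / (2 * (prs2 t)\<^sup>2) = 0 \<longleftrightarrow> skew_num t = 0" for t
    using prs2_pos[of t] prs1_ge[of t] gen_0_pos[of t] by (auto simp: prs3_def)
  then have "{t. (prs1 t)\<^sup>2 * prs3 t / (2 * (prs2 t)\<^sup>2) = 0} = {t. skew_num t = 0}" by blast
  then show ?thesis
    using zeros_le_Suc_zeros_deriv[OF defect_has_derivative] card_zeros_skew_num by auto
qed

text \<open>\<open>prs1\<close> is a weighted mean of 3, 63 and 12003 with positive weights. It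
  tends to the two extremes at the ends of the line, so the intermediate value theorem fills the
  interval.\<close>

lemma range_prs1: "range prs1 = {3<..<12003}"
proof
  have "gen 1 t < 200 * gen 0 t" for t by (simp add: gen_def add_pos_pos)
  moreover have "0 < gen 1 t" for t by (simp add: gen_def add_pos_pos)
  ultimately have *: "0 < gen 1 t / gen 0 t" "gen 1 t / gen 0 t < 200" for t
    using gen_0_pos[of t] by (simp_all add: pos_divide_less_eq)
  then have "3 < prs1 t" "prs1 t < 12003" for t
    unfolding prs1_def using *[of t] by linarith+
  then show "range prs1 \<subseteq> {3<..<12003}" by auto
next
  have cont: "isCont prs1 t" for t by (rule DERIV_isCont[OF prs1_has_derivative])
  \<comment> \<open>The limit is left unevaluated so that the limit rules match it term by
    term.\<close>
  have bot: "(prs1 \<longlongrightarrow> 3 + 60 * ((0 ^ 1 + 2 * 0 + 200 ^ 1 * 0 ^ 200) / (0 ^ 0 + 2 * 0 + 200 ^ 0 * 0 ^ 200))) at_bot"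
  proof -
    have "filterlim (\<lambda>t::real. 60 * t) at_bot at_bot"
      by (rule filterlim_tendsto_pos_mult_at_bot[OF tendsto_const]) (auto intro: filterlim_ident)
    then have "((\<lambda>t::real. exp (60 * t)) \<longlongrightarrow> 0) at_bot" by (rule filterlim_compose[OF exp_at_bot])
    then show ?thesis unfolding prs1_def[abs_def] gen_def
      by (intro tendsto_intros) auto
  qed
  \<comment> \<open>Numerator and denominator are divided by \<open>z ^ 200\<close>, which leaves
    powers of \<open>exp (- 60 * t)\<close>.\<close>
  have top: "(prs1 \<longlongrightarrow> 3 + 60 * ((2 * 0 ^ 199 + 200) / (0 ^ 200 + 2 * 0 ^ 199 + 1))) at_top"
  proof -
    have "filterlim (\<lambda>t::real. - 60 * t) at_bot at_top"
      by (rule filterlim_tendsto_neg_mult_at_bot[OF tendsto_const]) (auto intro: filterlim_ident)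
    then have "((\<lambda>t::real. exp (- 60 * t)) \<longlongrightarrow> 0) at_top" by (rule filterlim_compose[OF exp_at_bot])
    then have "((\<lambda>t::real. 3 + 60 * ((2 * exp (- 60 * t) ^ 199 + 200) /
        (exp (- 60 * t) ^ 200 + 2 * exp (- 60 * t) ^ 199 + 1))) \<longlongrightarrow>
        3 + 60 * ((2 * 0 ^ 199 + 200) / (0 ^ 200 + 2 * 0 ^ 199 + 1))) at_top"
      by (intro tendsto_intros) auto
    moreover have "3 + 60 * ((2 * exp (- 60 * t) ^ 199 + 200) /
        (exp (- 60 * t) ^ 200 + 2 * exp (- 60 * t) ^ 199 + 1)) = prs1 t" for t
    proof -
      define z w where "z = exp (60 * t)" and "w = exp (- 60 * t)"
      have zw: "z * w = 1" by (simp add: z_def w_def mult_exp_exp)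
      have "z ^ 199 * w ^ 199 = 1" "z ^ 200 * w ^ 200 = 1"
        by (simp_all only: power_mult_distrib[symmetric] zw power_one)
      moreover have "z ^ 200 = z * z ^ 199" by (simp flip: power_Suc)
      ultimately have "z ^ 200 * w ^ 199 = z" "z ^ 200 * w ^ 200 = 1" by (simp_all only: mult.assoc mult_1_right)
      then have "gen 1 t = z ^ 200 * (2 * w ^ 199 + 200)" "gen 0 t = z ^ 200 * (w ^ 200 + 2 * w ^ 199 + 1)"
        unfolding gen_def z_def[symmetric] by (simp_all add: algebra_simps)
      moreover have "z ^ 200 \<noteq> 0" by (simp add: z_def)
      ultimately show ?thesis by (simp add: prs1_def w_def)
    qed
    ultimately show ?thesis by simp
  qed
  show "{3<..<12003} \<subseteq> range prs1"
  proof
    fix \<beta> :: real assume \<beta>: "\<beta> \<in> {3<..<12003}"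
    have "\<forall>\<^sub>F t in at_bot. prs1 t < \<beta>" using \<beta> by (intro order_tendstoD[OF bot]) auto
    then obtain s where s: "prs1 s < \<beta>" using eventually_happens' trivial_limit_at_bot_linorder by blast
    have "\<forall>\<^sub>F t in at_top. \<beta> < prs1 t" using \<beta> by (intro order_tendstoD[OF top]) auto
    then obtain t where t: "\<beta> < prs1 t" using eventually_happens' trivial_limit_at_top_linorder by blast
    have "\<exists>x. prs1 x = \<beta>"
    proof (cases "s \<le> t")
      case True
      then show ?thesis using IVT[of prs1 s \<beta> t] s t cont by auto
    next
      case False
      then show ?thesis using IVT2[of prs1 s \<beta> t] s t cont by auto
    qed
    then show "\<beta> \<in> range prs1" by blast
  qed
qed

section \<open>Signs of the defect at five points\<close>

definition at_scale :: "real \<Rightarrow> real" where "at_scale z = ln z / 60"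

lemma at_scale_mono: "\<lbrakk>0 < x; x < y\<rbrakk> \<Longrightarrow> at_scale x < at_scale y"
  by (simp add: at_scale_def)

lemma exp_at_scale: "0 < z \<Longrightarrow> exp (60 * at_scale z) = z"
  by (simp add: at_scale_def)

lemma gen_at_scale: "0 < z \<Longrightarrow> gen k (at_scale z) = 0 ^ k + 2 * z + 200 ^ k * z ^ 200"
  by (simp add: gen_def exp_at_scale)

lemma prs_at_scale: "0 < z \<Longrightarrow> prs (at_scale z) = ln z / 20 + ln (1 + 2 * z + z ^ 200)"
  by (simp add: prs_def gen_at_scale) (simp add: at_scale_def)

lemma prs2_at_scale:
  "0 < z \<Longrightarrow> prs2 (at_scale z) =
     3600 * ((2 * z + 40000 * z ^ 200 + 79202 * z * z ^ 200) / (1 + 2 * z + z ^ 200)\<^sup>2)"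
  by (simp add: prs2_def gen_at_scale var_num_eq[OF exp_at_scale[symmetric]])

lemma prs1_at_scale:
  "0 < z \<Longrightarrow> prs1 (at_scale z) = 3 + 60 * ((2 * z + 200 * z ^ 200) / (1 + 2 * z + z ^ 200))"
  by (simp add: prs1_def gen_at_scale)

text \<open>At this scale the pressure is not positive: \<open>ln z / 20\<close> is at most -1/20,
  while the other logarithm is at most 3/64. The square of \<open>prs1\<close> then decides.\<close>

lemma defect_neg_1: "defect (at_scale (1 / 64)) < 0"
proof -
  define y :: real where "y = (1 / 64) ^ 200"
  have y: "0 \<le> y" "y \<le> 1 / 64"
    unfolding y_def using power_decreasing[of 1 200 "1 / 64 :: real"] by simp_all
  have "exp 1 \<le> (64 :: real)" using exp_le by simp
  then have "1 \<le> ln (64 :: real)" by (simp add: ln_ge_iff)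
  then have "ln (1 / 64 :: real) / 20 \<le> - 1 / 20" by (simp add: ln_div)
  moreover have "ln (1 + 2 * (1 / 64) + y) \<le> 1 + 2 * (1 / 64) + y - 1"
    using y by (intro ln_le_minus_one) simp
  ultimately have "prs (at_scale (1 / 64)) \<le> 0"
    using y by (simp add: prs_at_scale y_def)
  then have "2 * prs (at_scale (1 / 64)) * prs2 (at_scale (1 / 64)) \<le> 0"
    using prs2_pos[of "at_scale (1 / 64)"] by (simp add: mult_nonpos_nonneg)
  also have "0 < (prs1 (at_scale (1 / 64)))\<^sup>2" using prs1_ge[of "at_scale (1 / 64)"] by simp
  finally show ?thesis by (simp add: defect_sign)
qed

text \<open>Up to the tiny \<open>y\<close>, the exponents 3 and 63 carry equal mass: mean 33,
  variance 900, pressure \<open>19 / 20 * ln 2\<close>. Twice pressure times variance exceeds 1132,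
  against a squared mean below 1090.\<close>

lemma defect_pos_2: "0 < defect (at_scale (1 / 2))"
proof -
  define y :: real where "y = (1 / 2) ^ 200"
  have y: "0 < y" "y \<le> 1 / 1000000000"
    unfolding y_def using power_decreasing[of 30 200 "1 / 2 :: real"] by (simp_all add: power_divide)
  let ?t = "at_scale (1 / 2)"
  have "ln 2 \<le> ln (2 + y)" using y by simp
  then have "19 / 20 * ln 2 \<le> prs ?t"
    by (simp add: prs_at_scale y_def ln_div)
  then have P: "63 / 100 \<le> prs ?t" using ln2_ge_two_thirds by simp
  have P2: "899 \<le> prs2 ?t"
  proof -
    have "(2 + y)\<^sup>2 \<le> (2 + 1 / 1000000000)\<^sup>2" using y by (intro power_mono) auto
    then have "899 * (2 + y)\<^sup>2 \<le> 3600 * (1 + 40000 * y + 39601 * y)"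
      using y by (simp add: power2_eq_square)
    then show ?thesis using y by (simp add: prs2_at_scale flip: y_def) (simp add: field_simps)
  qed
  have P1: "prs1 ?t \<le> 3301 / 100"
  proof -
    have "(1 + 200 * y) * 6000 \<le> 3001 * (2 + y)" using y by simp
    then show ?thesis using y by (simp add: prs1_at_scale flip: y_def) (simp add: field_simps)
  qed
  have "(prs1 ?t)\<^sup>2 \<le> (3301 / 100)\<^sup>2" using P1 prs1_ge[of ?t] by (intro power_mono) auto
  also have "\<dots> < 2 * (63 / 100) * 899" by (simp add: power2_eq_square)
  also have "\<dots> \<le> 2 * prs ?t * prs2 ?t" using P P2 by (intro mult_mono) auto
  finally show ?thesis by (simp add: defect_sign)
qed

text \<open>The largest exponent is still negligible, but the mean has risen to about 41.57 and the
  variance has dropped to about 826.5. The margin is narrow, 1720.16 against 1722.25, hence the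
  careful bound on the logarithm.\<close>

lemma defect_neg_3: "defect (at_scale (9 / 10)) < 0"
proof -
  define y :: real where "y = (9 / 10) ^ 200"
  have y: "0 < y" "y \<le> 1 / 1000000000"
  proof -
    have "y = ((9 / 10) ^ 20) ^ 10" by (simp add: y_def flip: power_mult)
    also have "\<dots> \<le> (1 / 8) ^ 10" by (intro power_mono) (simp_all add: power_divide)
    finally show "y \<le> 1 / 1000000000" by (simp add: power_divide)
  qed (simp add: y_def)
  let ?t = "at_scale (9 / 10)"
  have P: "prs ?t \<le> 104 / 100"
  proof -
    \<comment> \<open>The quadratic Taylor bound is too weak at 1.04 itself; applied at a quarter of
      it and raised to the fourth power it just exceeds 14/5.\<close>
    have "1 + 26 / 100 + (26 / 100)\<^sup>2 / 2 \<le> exp (26 / 100 :: real)"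
      by (rule exp_lower_Taylor_quadratic) simp
    then have "(12938 / 10000) ^ 4 \<le> exp (26 / 100 :: real) ^ 4"
      by (intro power_mono) (simp_all add: power2_eq_square)
    also have "exp (26 / 100 :: real) ^ 4 = exp (104 / 100)" by (simp flip: exp_of_nat_mult)
    finally have "14 / 5 + y \<le> exp (104 / 100)" using y by (simp add: power_divide)
    then have "ln (14 / 5 + y) \<le> 104 / 100"
      using y ln_le_cancel_iff[of "14 / 5 + y" "exp (104 / 100)"] by simp
    moreover have "ln (9 / 10 :: real) \<le> 0" by simp
    moreover have "prs ?t = ln (9 / 10) / 20 + ln (14 / 5 + y)" by (simp add: prs_at_scale y_def)
    ultimately show ?thesis by linarith
  qed
  have P2: "prs2 ?t \<le> 827"
  proof -
    have "(14 / 5)\<^sup>2 \<le> (14 / 5 + y)\<^sup>2" using y by (intro power_mono) auto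
    then have "3600 * (9 / 5 + 40000 * y + 79202 * (9 / 10) * y) \<le> 827 * (14 / 5 + y)\<^sup>2"
      using y by (simp add: power2_eq_square)
    then show ?thesis using y by (simp add: prs2_at_scale flip: y_def) (simp add: field_simps)
  qed
  have P1: "415 / 10 \<le> prs1 ?t"
  proof -
    have "385 * (14 / 5 + y) \<le> 600 * (9 / 5 + 200 * y)" using y by simp
    then show ?thesis using y by (simp add: prs1_at_scale flip: y_def) (simp add: field_simps)
  qed
  have "2 * prs ?t * prs2 ?t \<le> 2 * (104 / 100) * prs2 ?t"
    using P prs2_pos[of ?t] by (intro mult_right_mono) auto
  also have "\<dots> \<le> 2 * (104 / 100) * 827" using P2 by simp
  also have "\<dots> < (415 / 10)\<^sup>2" by (simp add: power2_eq_square)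
  also have "\<dots> \<le> (prs1 ?t)\<^sup>2" using P1 by (intro power_mono) auto
  finally show ?thesis by (simp add: defect_sign)
qed

text \<open>Now the exponent 12003 holds a quarter of the mass, so the variance far outweighs the
  squared mean.\<close>

lemma defect_pos_4: "0 < defect (at_scale 1)"
proof -
  have "ln (exp 1) \<le> ln (4 :: real)" using exp_le by (subst ln_le_cancel_iff) auto
  then have P: "1 \<le> prs (at_scale 1)" by (simp add: prs_at_scale)
  have "(prs1 (at_scale 1))\<^sup>2 < 2 * 1 * prs2 (at_scale 1)"
    by (simp add: prs1_at_scale prs2_at_scale power2_eq_square)
  also have "\<dots> \<le> 2 * prs (at_scale 1) * prs2 (at_scale 1)"
    using P prs2_pos[of "at_scale 1"] by (intro mult_right_mono) auto
  finally show ?thesis by (simp add: defect_sign)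
qed

text \<open>The largest exponent dominates and the variance nearly vanishes, so the crude bounds 202
  for the pressure and 3 for the mean suffice.\<close>

lemma defect_neg_5: "defect (at_scale 2) < 0"
proof -
  define y :: real where "y = 2 ^ 200"
  have y: "1000000000000 \<le> y"
    unfolding y_def using power_increasing[of 40 200 "2 :: real"] by simp
  let ?t = "at_scale 2"
  have P: "prs ?t \<le> 202"
  proof -
    have "ln (5 + y) \<le> ln (2 * y)" using y by simp
    also have "\<dots> = ln 2 + ln y" using y by (intro ln_mult_pos) auto
    also have "ln y = 200 * ln 2" unfolding y_def by (subst ln_realpow) simp_all
    finally have "ln (5 + y) \<le> ln 2 + 200 * ln 2" .
    moreover have "prs ?t = ln 2 / 20 + ln (5 + y)" by (simp add: prs_at_scale y_def)
    ultimately show ?thesis using ln_2_less_1 by linarith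
  qed
  have P2: "prs2 ?t \<le> 1 / 1000"
  proof -
    have "3600000 * (4 + 40000 * y + 158404 * y) \<le> 1000000000000 * y" using y by simp
    also have "\<dots> \<le> y * y" using y by (intro mult_right_mono) auto
    also have "\<dots> \<le> (5 + y)\<^sup>2" using y by (simp add: power2_eq_square algebra_simps)
    finally show ?thesis using y by (simp add: prs2_at_scale flip: y_def)
  qed
  have "2 * prs ?t * prs2 ?t \<le> 2 * 202 * prs2 ?t"
    using P prs2_pos[of ?t] by (intro mult_right_mono) auto
  also have "\<dots> \<le> 2 * 202 * (1 / 1000)" using P2 by simp
  also have "\<dots> < 3\<^sup>2" by simp
  also have "\<dots> \<le> (prs1 ?t)\<^sup>2" using prs1_ge by (intro power_mono) auto
  finally show ?thesis by (simp add: defect_sign)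
qed

text \<open>Four sign changes at five increasing points give four separated zeros, which meets the
  upper bound.\<close>

lemma card_zeros_defect: "card {t. defect t = 0} = 4"
proof -
  have cont: "isCont defect t" for t by (rule DERIV_isCont[OF defect_has_derivative])
  have up: "\<exists>c. s < c \<and> c < t \<and> defect c = 0" if "s < t" "defect s < 0" "0 < defect t" for s t
    using IVT[of defect s 0 t] that cont by (metis less_le less_irrefl)
  have down: "\<exists>c. s < c \<and> c < t \<and> defect c = 0" if "s < t" "0 < defect s" "defect t < 0" for s t
    using IVT2[of defect t 0 s] that cont by (metis less_le less_irrefl)
  obtain a where a: "at_scale (1 / 64) < a" "a < at_scale (1 / 2)" "defect a = 0"
    using up[OF at_scale_mono defect_neg_1 defect_pos_2] by auto
  obtain b where b: "at_scale (1 / 2) < b" "b < at_scale (9 / 10)" "defect b = 0"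
    using down[OF at_scale_mono defect_pos_2 defect_neg_3] by auto
  obtain c where c: "at_scale (9 / 10) < c" "c < at_scale 1" "defect c = 0"
    using up[OF at_scale_mono defect_neg_3 defect_pos_4] by auto
  obtain d where d: "at_scale 1 < d" "d < at_scale 2" "defect d = 0"
    using down[OF at_scale_mono defect_pos_4 defect_neg_5] by auto
  have "a < b" "b < c" "c < d" using a b c d by linarith+
  then have "card {a, b, c, d} = 4" by simp
  moreover have "card {a, b, c, d} \<le> card {t. defect t = 0}"
    using a b c d card_zeros_defect_le by (intro card_mono) auto
  ultimately show ?thesis using card_zeros_defect_le by simp
qed

section \<open>The map with four inflections\<close>

text \<open>The values are 3 plus 60 times 0, 1, 1, 200. The repeated exponent yields the
  coefficient 2 in \<open>gen\<close>, and the common part 3 yields the term \<open>3 * t\<close> in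
  \<open>prs\<close>.\<close>

definition exponents :: "nat \<Rightarrow> real" where
  "exponents i = (if i = 1 then 3 else if i = 4 then 12003 else 63)"

text \<open>Since \<open>exp 3\<close> is at least 8, each interval fits into the left half of its
  quarter of the unit interval and leaves a gap of at least 1/8.\<close>

lemma separated_quarters: "separated_pl_map 4 exponents (\<lambda>i. (real i - 1) / 4) (1 / 8)"
proof
  have e: "exp (- exponents i) \<le> 1 / 8" for i
  proof -
    have "1 + 3 + 3\<^sup>2 / 2 \<le> exp (3 :: real)" by (rule exp_lower_Taylor_quadratic) simp
    then have "8 \<le> exp (3 :: real)" by simp
    also have "\<dots> \<le> exp (exponents i)" by (simp add: exponents_def)
    finally show ?thesis by (simp add: exp_minus field_simps)
  qed
  show "(real i - 1) / 4 + exp (- exponents i) \<le> 1" if "i \<in> {1..4}" for i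
  proof -
    have "(real i - 1) / 4 + exp (- exponents i) \<le> 3 / 4 + 1 / 8"
      using that by (intro add_mono e) simp
    also have "\<dots> \<le> 1" by simp
    finally show ?thesis .
  qed
  have order: "1 / 8 \<le> \<bar>x - y\<bar>"
    if "i < j" "x \<in> {(real i - 1) / 4..(real i - 1) / 4 + exp (- exponents i)}"
      "y \<in> {(real j - 1) / 4..(real j - 1) / 4 + exp (- exponents j)}" for i j x y
  proof -
    have "(real i - 1) / 4 + 1 / 4 \<le> (real j - 1) / 4" using that(1) by (simp add: field_simps)
    moreover have "x \<le> (real i - 1) / 4 + 1 / 8" using that(2) add_left_mono[OF e[of i], of "(real i - 1) / 4"] by auto
    moreover have "(real j - 1) / 4 \<le> y" using that(3) by simp
    ultimately have "1 / 8 \<le> y - x" by linarith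
    then show ?thesis by linarith
  qed
  show "1 / 8 \<le> \<bar>x - y\<bar>"
    if "i \<noteq> j" "x \<in> {(real i - 1) / 4..(real i - 1) / 4 + exp (- exponents i)}"
      "y \<in> {(real j - 1) / 4..(real j - 1) / 4 + exp (- exponents j)}" for i j x y
    using that order[of i j x y] order[of j i y x] by (cases i j rule: linorder_cases) (auto simp: abs_minus_commute)
qed (auto simp: exponents_def)

theorem theorem2p4:
  "\<exists>(X :: nat \<Rightarrow> real set) (f :: nat \<Rightarrow> real \<Rightarrow> real).
     pl_expanding_map 4 X f \<and> card {\<alpha>. lyapunov_inflection 4 X f \<alpha>} = 4"
proof -
  interpret separated_pl_map 4 exponents "\<lambda>i. (real i - 1) / 4" "1 / 8"
    by (rule separated_quarters)
  have "pl_expanding_map 4 X f"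
    by (rule pl_expanding_map) (auto simp: exponents_def)
  moreover have "card {\<alpha>. lyapunov_inflection 4 X f \<alpha>} = 4"
  proof -
    have pressure: "pressure = prs"
    proof
      fix t
      have "{1..4::nat} = {1, 2, 3, 4}" by auto
      then have "(\<Sum>i = 1..4. exp (t * exponents i)) = exp (t * 3) + 2 * exp (t * 63) + exp (t * 12003)"
        by (simp add: exponents_def)
      also have "\<dots> = exp (3 * t) * gen 0 t"
        by (simp add: gen_def algebra_simps mult_exp_exp flip: exp_of_nat_mult)
      finally show "pressure t = prs t"
        using gen_0_pos[of t] by (simp add: pressure_def prs_def ln_mult)
    qed
    have L: "lyapunov_spectrum 4 X f (prs1 t) = prs t / prs1 t - t" for t
      using lyapunov_spectrum_eq[of "prs1 t" t] prs_has_derivative[of t] prs1_ge[of t]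
      by (simp add: pressure)
    have ends: "ln (slope X 1) = 3" "ln (slope X 4) = 12003" by (simp_all add: slope_X exponents_def)
    have "{\<alpha>. lyapunov_inflection 4 X f \<alpha>} = prs1 ` {t. 2 * prs t * prs2 t = (prs1 t)\<^sup>2}"
      unfolding lyapunov_inflection_def ends
      by (rule inflections_legendre(1)[OF prs_has_derivative prs1_has_derivative prs2_pos range_prs1 _ L]) simp
    also have "\<dots> = prs1 ` {t. defect t = 0}" by (simp add: defect_sign)
    also have "card \<dots> = card {t. defect t = 0}"
      using inflections_legendre(2)[OF prs_has_derivative prs1_has_derivative prs2_pos range_prs1 _ L]
      by (intro card_image) (auto intro: inj_on_subset)
    finally show ?thesis by (simp add: card_zeros_defect)
  qed
  ultimately show ?thesis by blast
qed

end
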